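(* Let $k\geq 2$ and let $\mathcal{F}\subset\binom{[n]}{k}$ be an intersecting family. Define the real number $\alpha$ by $\gamma(\mathcal{F})=(1-\alpha)\binom{n-3}{k-2}$. Let $d$ be an integer with $d\geq 36$. If $0\leq\alpha<1$ and $n\geq\frac{dk}{1-\alpha}$, then there exists a 3-element set $\{u,v,w\}\subset[n]$ such that \[ |\mathcal{F}\setminus\mathcal{F}_{uvw}^*|\leq\frac{d\alpha}{2}\binom{n-d+3}{k-d+3} \] and \[ |\mathcal{F}_{uvw}\setminus\mathcal{F}|\leq 3\alpha\binom{n-3}{k-2}+\frac{3d\alpha}{2}\binom{n-d+3}{k-d+3}. \]
   Context: $[n]=\{1,\ldots,n\}$ and $\binom{[n]}{k}$ is the collection of all $k$-element subsets of $[n]$. A family $\mathcal{F}\subset\binom{[n]}{k}$ is intersecting if $F\cap F'\neq\emptyset$ for all $F,F'\in\mathcal{F}$. For $x\in[n]$, $\mathcal{F}(x)=\{F\setminus\{x\}\colon x\in F\in\mathcal{F}\}$; $\Delta(\mathcal{F})=\max_{1\leq x\leq n}|\mathcal{F}(x)|$ is the maximum degree, and $\gamma(\mathcal{F})=|\mathcal{F}|-\Delta(\mathcal{F})$ is the diversity. For a 3-element set $\{u,v,w\}\subset[n]$, \[ \mathcal{F}_{uvw}=\left\{F\in\binom{[n]}{k}\colon |F\cap\{u,v,w\}|=2\right\},\quad \mathcal{F}_{uvw}^*=\left\{F\in\binom{[n]}{k}\colon |F\cap\{u,v,w\}|\geq 2\right\}. \] A binomial coefficient $\binom{a}{b}$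 with $b<0$ is $0$. *)

theory Defs
  imports Complex_Main "HOL-Library.Ramsey"
begin

definition intersecting :: "'a set set \<Rightarrow> bool" where
  "intersecting F \<longleftrightarrow> (\<forall>A\<in>F. \<forall>B\<in>F. A \<inter> B \<noteq> {})"

definition link :: "'a set set \<Rightarrow> 'a \<Rightarrow> 'a set set" where
  "link F x = {A - {x} |A. A \<in> F \<and> x \<in> A}"

definition max_degree :: "nat \<Rightarrow> nat set set \<Rightarrow> nat" where
  "max_degree n F = Max ((\<lambda>x. card (link F x)) ` {1..n})"

definition diversity :: "nat \<Rightarrow> nat set set \<Rightarrow> int" where
  "diversity n F = int (card F) - int (max_degree n F)"

definition two_family :: "nat \<Rightarrow> nat \<Rightarrow> nat \<Rightarrow> nat \<Rightarrow> nat \<Rightarrow> nat set set" where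
  "two_family n k u v w = {A \<in> nsets {1..n} k. card (A \<inter> {u, v, w}) = 2}"

definition two_family_star :: "nat \<Rightarrow> nat \<Rightarrow> nat \<Rightarrow> nat \<Rightarrow> nat \<Rightarrow> nat set set" where
  "two_family_star n k u v w = {A \<in> nsets {1..n} k. card (A \<inter> {u, v, w}) \<ge> 2}"

text \<open>Binomial coefficient with integer arguments, zero for a negative lower index.
  Integer arguments avoid truncated subtraction on \<^typ>\<open>nat\<close>.\<close>

definition ibinom :: "int \<Rightarrow> int \<Rightarrow> real" where
  "ibinom a b = (if b < 0 then 0 else of_int a gchoose nat b)"

lemma ibinom_of_nat: "ibinom (int a) (int b) = real (a choose b)"
  by (simp add: ibinom_def binomial_gbinomial)

end

theory Submission imports Defs begin

text \<open>Write \<open>u\<close> for the number of \<open>k\<close>-sets containing three given points. The crucial fact is that a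
  \<open>k\<close>-uniform intersecting family with more than \<open>28 u\<close> members has a vertex of degree more than
  \<open>8 u\<close>. It is proved by compressing until some degree first exceeds its bound; that vertex is then
  frozen (compressions of the remaining points do not change its degree), and compressing further
  either yields a vertex contradicting the Kruskal-Katona bound for cross-intersecting families or
  ends in a fully compressed family, in which the reflection principle bounds the number of sets
  that avoid the first two points. Applying this to the sets that avoid a vertex \<open>x\<close> of maximum
  degree gives \<open>y\<close> such that many sets meet \<open>{x, y}\<close> in \<open>x\<close> only, and many in \<open>y\<close> only. These two
  cross-intersecting families must concentrate on a common \<open>w\<close>, so that all three pairs of
  \<open>{x, y, w}\<close> are heavy. Now every set meeting the triple in at most one point is
  cross-intersecting with a heavy pair. This first bounds the number \<open>r\<close> of such sets by \<open>u\<close>, and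
  feeding this bound back into Kruskal-Katona gives \<open>r P \<le> E (\<alpha> X + r)\<close>, where \<open>X\<close>, \<open>P\<close>, \<open>E\<close> are
  the binomial coefficients \<open>(n-3 choose k-2)\<close>, \<open>(n-d choose k-2)\<close>, \<open>(n-d+3 choose k-d+3)\<close>; since
  \<open>P\<close> has the order of \<open>X\<close>, the claim follows.\<close>

section \<open>Compressions\<close>

definition swap_in :: "nat \<Rightarrow> nat \<Rightarrow> nat set \<Rightarrow> nat set" where
  "swap_in i j B = (if j \<in> B \<and> i \<notin> B then insert i (B - {j}) else B)"

text \<open>The Erdos-Ko-Rado compression. A member whose image already lies in \<open>F\<close>
  stays put, which makes the map injective on \<open>F\<close> and keeps the size.\<close>

definition shift :: "nat \<Rightarrow> nat \<Rightarrow> nat set set \<Rightarrow> nat set set" where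
  "shift i j F = (\<lambda>B. if swap_in i j B \<in> F then B else swap_in i j B) ` F"

lemma inj_on_shift: "inj_on (\<lambda>B. if swap_in i j B \<in> F then B else swap_in i j B) F"
proof (rule inj_onI)
  fix B C assume B: "B \<in> F" and C: "C \<in> F"
    and eq: "(if swap_in i j B \<in> F then B else swap_in i j B) = (if swap_in i j C \<in> F then C else swap_in i j C)"
  show "B = C"
  proof (cases "swap_in i j B \<in> F \<or> swap_in i j C \<in> F")
    case True
    then show ?thesis using eq B C by (auto split: if_splits)
  next
    case False
    then have "swap_in i j B = swap_in i j C" "j \<in> B" "i \<notin> B" "j \<in> C" "i \<notin> C"
      using eq B C by (auto simp: swap_in_def split: if_splits)
    then show ?thesis by (auto simp: swap_in_def)
  qed
qed

lemma card_shift: "card (shift i j F) = card F"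
  unfolding shift_def by (rule card_image[OF inj_on_shift])

lemma mem_shift_other:
  assumes "\<not> (i \<in> C \<and> j \<notin> C)" "\<not> (j \<in> C \<and> i \<notin> C)"
  shows "C \<in> shift i j F \<longleftrightarrow> C \<in> F"
  using assms by (auto simp: shift_def swap_in_def image_iff split: if_splits)

lemma mem_shift_old:
  assumes "j \<in> C" "i \<notin> C"
  shows "C \<in> shift i j F \<longleftrightarrow> C \<in> F \<and> insert i (C - {j}) \<in> F"
  using assms by (auto simp: shift_def swap_in_def image_iff split: if_splits)

lemma mem_shift_new:
  assumes "i \<in> C" "j \<notin> C"
  shows "C \<in> shift i j F \<longleftrightarrow> C \<in> F \<or> insert j (C - {i}) \<in> F"
proof
  assume "C \<in> shift i j F"
  then obtain B where B: "B \<in> F" "C = (if swap_in i j B \<in> F then B else swap_in i j B)"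
    by (auto simp: shift_def)
  show "C \<in> F \<or> insert j (C - {i}) \<in> F"
  proof (cases "swap_in i j B \<in> F")
    case False
    then have "j \<in> B" "i \<notin> B" using B by (auto simp: swap_in_def split: if_splits)
    then have "insert j (C - {i}) = B" using B False assms by (auto simp: swap_in_def)
    then show ?thesis using B by simp
  qed (use B in auto)
next
  assume "C \<in> F \<or> insert j (C - {i}) \<in> F"
  then show "C \<in> shift i j F"
  proof (cases "C \<in> F")
    case True
    have "swap_in i j C = C" using assms by (simp add: swap_in_def)
    then show ?thesis using True unfolding shift_def by (auto intro!: image_eqI[of _ _ C])
  next
    case False
    then have B: "insert j (C - {i}) \<in> F" using \<open>C \<in> F \<or> _\<close> by blast
    have "swap_in i j (insert j (C - {i})) = C" using assms by (auto simp: swap_in_def)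
    then show ?thesis using B False unfolding shift_def
      by (auto intro!: image_eqI[of _ _ "insert j (C - {i})"])
  qed
qed

lemma shift_mem_cases [consumes 1, case_names keep move]:
  assumes "C \<in> shift i j F"
  obtains "C \<in> F" "j \<in> C \<Longrightarrow> i \<notin> C \<Longrightarrow> insert i (C - {j}) \<in> F"
    | "i \<in> C" "j \<notin> C" "insert j (C - {i}) \<in> F"
proof (cases "C \<in> F")
  case True
  then show ?thesis using that(1) assms mem_shift_old by blast
next
  case False
  then show ?thesis using that(2) assms mem_shift_other mem_shift_old mem_shift_new by metis
qed

lemma card_swap: "finite C \<Longrightarrow> i \<in> C \<Longrightarrow> j \<notin> C \<Longrightarrow> card (insert j (C - {i})) = card C"
  using card.remove[of C i] by simp

lemma shift_nsets:
  assumes "F \<subseteq> nsets X k" "i \<in> X" "j \<in> X"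
  shows "shift i j F \<subseteq> nsets X k"
proof
  fix C assume "C \<in> shift i j F"
  then show "C \<in> nsets X k"
  proof (cases rule: shift_mem_cases)
    case keep
    then show ?thesis using assms by blast
  next
    case move
    let ?D = "insert j (C - {i})"
    have D: "?D \<subseteq> X" "finite ?D" "card ?D = k" using move assms by (auto simp: nsets_def)
    have "C = insert i (?D - {j})" using move by auto
    moreover have "card (insert i (?D - {j})) = k"
      using D card_swap[of ?D j i] move assms by (cases "i = j") auto
    ultimately show ?thesis using D assms by (auto simp: nsets_def)
  qed
qed

text \<open>Two moved sets share \<open>i\<close>, and two kept sets were members before. A kept
  \<open>C\<close> disjoint from a moved \<open>D\<close> cannot contain \<open>i\<close>; then the
  preimage of \<open>D\<close> is disjoint from \<open>C\<close> or, if \<open>j\<close> lies in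
  \<open>C\<close>, from the image of \<open>C\<close>, which is in \<open>F\<close> because
  \<open>C\<close> was kept.\<close>

lemma intersecting_shift:
  assumes "intersecting F"
  shows "intersecting (shift i j F)"
  unfolding intersecting_def
proof (intro ballI notI)
  have int: "\<And>A B. A \<in> F \<Longrightarrow> B \<in> F \<Longrightarrow> A \<inter> B \<noteq> {}" using assms by (auto simp: intersecting_def)
  have mixed: False if "C \<in> F" "j \<in> C \<Longrightarrow> i \<notin> C \<Longrightarrow> insert i (C - {j}) \<in> F"
    "i \<in> D" "j \<notin> D" "insert j (D - {i}) \<in> F" "C \<inter> D = {}" for C D
  proof -
    have "i \<notin> C" using that by auto
    show False
    proof (cases "j \<in> C")
      case True
      then show False using int[OF that(2) that(5)] that \<open>i \<notin> C\<close> by auto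
    next
      case False
      then show False using int[OF that(1) that(5)] that \<open>i \<notin> C\<close> by auto
    qed
  qed
  fix C D assume C: "C \<in> shift i j F" and D: "D \<in> shift i j F" and dis: "C \<inter> D = {}"
  from C show False
  proof (cases rule: shift_mem_cases)
    case keep
    note c = keep
    from D show False
    proof (cases rule: shift_mem_cases)
      case keep
      then show False using int[of C D] c dis by blast
    next
      case move
      then show False using mixed[of C D] c dis by blast
    qed
  next
    case move
    note c = move
    from D show False
    proof (cases rule: shift_mem_cases)
      case keep
      then show False using mixed[of D C] c dis by blast
    next
      case move
      then show False using c dis by blast
    qed
  qed
qed

lemma shift_filter:
  assumes "\<And>B. R (swap_in i j B) = R B"
  shows "{B \<in> shift i j F. R B} = shift i j {B \<in> F. R B}"
proof -
  have "{B \<in> shift i j F. R B} = (\<lambda>B. if swap_in i j B \<in> F then B else swap_in i j B) ` {B \<in> F. R B}"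
    using assms by (auto simp: shift_def)
  also have "\<dots> = shift i j {B \<in> F. R B}"
    unfolding shift_def by (rule image_cong) (use assms in auto)
  finally show ?thesis .
qed

lemma sum_swap_in:
  assumes "i < j" "finite B"
  shows "\<Sum>(swap_in i j B) \<le> \<Sum>B" "swap_in i j B \<noteq> B \<Longrightarrow> \<Sum>(swap_in i j B) < \<Sum>B"
proof -
  have "\<Sum>(insert i (B - {j})) < \<Sum>B" if "j \<in> B" "i \<notin> B"
    using that assms sum.remove[of B j "\<lambda>x. x"] by simp
  then show "\<Sum>(swap_in i j B) \<le> \<Sum>B" "swap_in i j B \<noteq> B \<Longrightarrow> \<Sum>(swap_in i j B) < \<Sum>B"
    by (auto simp: swap_in_def less_imp_le split: if_splits)
qed

text \<open>The termination measure for repeated compression: trading \<open>j\<close> for a smaller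
  \<open>i\<close> lowers the sum of a set.\<close>

lemma shift_potential:
  assumes "i < j" "finite F" "\<And>B. B \<in> F \<Longrightarrow> finite B" "shift i j F \<noteq> F"
  shows "(\<Sum>B\<in>shift i j F. \<Sum>B) < (\<Sum>B\<in>F. \<Sum>B)"
proof -
  let ?g = "\<lambda>B. if swap_in i j B \<in> F then B else swap_in i j B"
  have eq: "(\<Sum>B\<in>shift i j F. \<Sum>B) = (\<Sum>B\<in>F. \<Sum>(?g B))"
    unfolding shift_def by (rule sum.reindex_cong[OF inj_on_shift refl refl])
  have "\<exists>B\<in>F. ?g B \<noteq> B"
  proof (rule ccontr)
    assume "\<not> ?thesis"
    then have "?g ` F = (\<lambda>B. B) ` F" by (intro image_cong) auto
    then show False using assms(4) by (simp add: shift_def)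
  qed
  then obtain B where B: "B \<in> F" "swap_in i j B \<notin> F" "swap_in i j B \<noteq> B" by (auto split: if_splits)
  have "(\<Sum>B\<in>F. \<Sum>(?g B)) < (\<Sum>B\<in>F. \<Sum>B)"
  proof (rule sum_strict_mono_ex1)
    show "\<forall>x\<in>F. \<Sum>(?g x) \<le> \<Sum>x" using sum_swap_in(1)[OF assms(1)] assms(3) by auto
    show "\<exists>a\<in>F. \<Sum>(?g a) < \<Sum>a" by (rule bexI[OF _ B(1)]) (use sum_swap_in(2)[OF assms(1) assms(3)[OF B(1)] B(3)] B(2) in simp)
  qed (rule assms(2))
  with eq show ?thesis by simp
qed

text \<open>\<open>R\<close> lists the allowed pairs, so a point is frozen by leaving it out of
  \<open>R\<close>; \<open>P\<close> collects the invariants that compressing must preserve.\<close>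

lemma ex_shift_stable:
  assumes "P F" "\<And>i j. (i, j) \<in> R \<Longrightarrow> i < j"
    and "\<And>G. P G \<Longrightarrow> finite G \<and> (\<forall>B\<in>G. finite B)"
    and closed: "\<And>G i j. P G \<Longrightarrow> (i, j) \<in> R \<Longrightarrow> P (shift i j G)"
  shows "\<exists>G. P G \<and> (\<forall>(i, j)\<in>R. shift i j G = G)"
  using assms(1)
proof (induction "\<Sum>B\<in>F. \<Sum>B" arbitrary: F rule: less_induct)
  case less
  show ?case
  proof (cases "\<forall>(i, j)\<in>R. shift i j F = F")
    case False
    then obtain i j where ij: "(i, j) \<in> R" "shift i j F \<noteq> F" by auto
    then show ?thesis
      using less.hyps[OF shift_potential closed[OF less.prems]] assms(2,3) less.prems by blast
  qed (use less.prems in blast)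
qed

section \<open>Shadows under compression\<close>

definition shadow :: "nat set set \<Rightarrow> nat set set" where
  "shadow F = {B - {x} |B x. B \<in> F \<and> x \<in> B}"

text \<open>Hence compression never enlarges the shadow. Deleting a point commutes with keeping or
  moving, except when \<open>i\<close> is deleted from a moved set: the rest then contains neither
  \<open>i\<close> nor \<open>j\<close> and already lies in the shadow of \<open>F\<close>.\<close>

lemma shadow_shift: "shadow (shift i j F) \<subseteq> shift i j (shadow F)"
proof
  fix E assume "E \<in> shadow (shift i j F)"
  then obtain C x where C: "C \<in> shift i j F" "x \<in> C" and E: "E = C - {x}"
    by (auto simp: shadow_def)
  from C(1) show "E \<in> shift i j (shadow F)"
  proof (cases rule: shift_mem_cases)
    case keep
    have ES: "E \<in> shadow F" using keep C E by (auto simp: shadow_def)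
    show ?thesis
    proof (cases "j \<in> E \<and> i \<notin> E")
      case True
      have "insert i (E - {j}) \<in> shadow F"
      proof (cases "i \<in> C")
        case True
        then have "insert i (E - {j}) = C - {j}" "j \<in> C" using E \<open>j \<in> E \<and> i \<notin> E\<close> by auto
        then show ?thesis using keep by (auto simp: shadow_def)
      next
        case False
        then have "insert i (C - {j}) \<in> F" using keep True E by auto
        moreover have "insert i (E - {j}) = insert i (C - {j}) - {x}" "x \<in> insert i (C - {j})"
          using E True False C by auto
        ultimately show ?thesis unfolding shadow_def by blast
      qed
      then show ?thesis using ES mem_shift_old[of j E i] True by blast
    next
      case False
      then show ?thesis using ES mem_shift_other[of i E j] mem_shift_new[of i E j] by blast
    qed
  next
    case move
    show ?thesis
    proof (cases "x = i")
      case True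
      then have "E = insert j (C - {i}) - {j}" using E move by auto
      then have "E \<in> shadow F" using move unfolding shadow_def by blast
      then show ?thesis using mem_shift_other[of i E j] E True move by auto
    next
      case False
      have "insert j (E - {i}) = insert j (C - {i}) - {x}" "x \<in> insert j (C - {i})"
        using E False move C by auto
      then have "insert j (E - {i}) \<in> shadow F" using move unfolding shadow_def by blast
      then show ?thesis using mem_shift_new[of i E j] E False move by blast
    qed
  qed
qed

lemma finite_shadow: "finite F \<Longrightarrow> (\<And>B. B \<in> F \<Longrightarrow> finite B) \<Longrightarrow> finite (shadow F)"
proof -
  assume "finite F" "\<And>B. B \<in> F \<Longrightarrow> finite B"
  moreover have "shadow F = (\<Union>B\<in>F. (\<lambda>x. B - {x}) ` B)" by (auto simp: shadow_def)
  ultimately show ?thesis by simp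
qed

lemma finite_shift: "finite F \<Longrightarrow> finite (shift i j F)"
  by (simp add: shift_def)

lemma card_shadow_shift:
  assumes "finite F" "\<And>B. B \<in> F \<Longrightarrow> finite B"
  shows "card (shadow (shift i j F)) \<le> card (shadow F)"
  using card_mono[OF finite_shift[OF finite_shadow[OF assms]] shadow_shift] by (simp add: card_shift)

section \<open>Shadows and cross-intersecting families\<close>

lemma obtain_subfamily:
  assumes "n \<le> card F"
  obtains G where "G \<subseteq> F" "card G = n"
  using obtain_subset_with_card_n[OF assms] by metis

lemma shadow_mono: "F \<subseteq> G \<Longrightarrow> shadow F \<subseteq> shadow G"
  by (auto simp: shadow_def)

lemma shadow_nsets: "F \<subseteq> nsets X (Suc t) \<Longrightarrow> shadow F \<subseteq> nsets X t"
  by (auto simp: shadow_def nsets_def)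

lemma shadow_nonempty:
  assumes "F \<subseteq> nsets X (Suc t)" "F \<noteq> {}"
  shows "shadow F \<noteq> {}"
proof -
  obtain B where B: "B \<in> F" using assms(2) by blast
  then have "B \<noteq> {}" using assms(1) by (auto simp: nsets_def)
  then show ?thesis using B by (auto simp: shadow_def)
qed

lemma finite_members: "F \<subseteq> nsets X t \<Longrightarrow> B \<in> F \<Longrightarrow> finite B"
  by (auto simp: nsets_def)

lemma binomial_succ_ratio: "t < M \<Longrightarrow> Suc t * (M choose Suc t) = (M - t) * (M choose t)"
  using binomial_absorb_comp[of M t] binomial_absorption[of t M] by simp

text \<open>The Lovasz form of Kruskal-Katona, in which \<open>M\<close> stays an integer: for \<open>F\<close> of size at most
  \<open>M choose t\<close>, the relative size does not decrease when passing to the shadow.\<close>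

theorem kruskal_katona_shadow:
  assumes "finite F" "F \<subseteq> nsets UNIV (Suc t)" "Suc t \<le> M" "card F \<le> M choose Suc t"
  shows "Suc t * card F \<le> (M - t) * card (shadow F)"
  using assms
proof (induction M arbitrary: t F)
  case 0
  then show ?case by simp
next
  case (Suc M)
  \<comment> \<open>Compressing towards the single point 0 suffices for the induction; the size
    stays and the shadow does not grow.\<close>
  define P where "P G \<longleftrightarrow> finite G \<and> G \<subseteq> nsets UNIV (Suc t) \<and> card G = card F
    \<and> card (shadow G) \<le> card (shadow F)" for G :: "nat set set"
  have "\<exists>G. P G \<and> (\<forall>(i, j)\<in>{(i, j). i = 0 \<and> 0 < j}. shift i j G = G)"
  proof (rule ex_shift_stable)
    show "P F" using Suc.prems by (simp add: P_def)
    show "finite G \<and> (\<forall>B\<in>G. finite B)" if "P G" for G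
      using that finite_members by (auto simp: P_def)
    show "P (shift i j G)" if "P G" for i j G
    proof -
      have G: "finite G" "G \<subseteq> nsets UNIV (Suc t)" "card G = card F" "card (shadow G) \<le> card (shadow F)"
        using that by (auto simp: P_def)
      have "card (shadow (shift i j G)) \<le> card (shadow G)"
        using card_shadow_shift[of G i j] G finite_members by blast
      then show ?thesis using G finite_shift[of G i j] shift_nsets[of G UNIV "Suc t" i j]
        by (auto simp: P_def card_shift)
    qed
  qed auto
  then obtain G where "P G" and stable: "\<And>j. 0 < j \<Longrightarrow> shift 0 j G = G" by blast
  then have G: "finite G" "G \<subseteq> nsets UNIV (Suc t)" "card G = card F" "card (shadow G) \<le> card (shadow F)"
    by (auto simp: P_def)
  have fin: "\<And>B. B \<in> G \<Longrightarrow> finite B" using G(2) finite_members by blast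
  \<comment> \<open>Split at 0. Stability will put the shadow of \<open>G0\<close> inside
    \<open>G1\<close>, while the shadow of \<open>G\<close> contains \<open>G1\<close> and,
    disjointly from it, a copy of the shadow of \<open>G1\<close> with 0 added.\<close>
  define G0 where "G0 = {B \<in> G. 0 \<notin> B}"
  define G1 where "G1 = (\<lambda>B. B - {0}) ` {B \<in> G. 0 \<in> B}"
  have finG: "finite G0" "finite G1" using G(1) by (auto simp: G0_def G1_def)
  have G0n: "G0 \<subseteq> nsets UNIV (Suc t)" using G(2) by (auto simp: G0_def)
  have G1n: "G1 \<subseteq> nsets UNIV t" using G(2) by (auto simp: G1_def nsets_def)
  have z1: "\<And>B. B \<in> G1 \<Longrightarrow> 0 \<notin> B" by (auto simp: G1_def)
  have inj1: "inj_on (\<lambda>B. B - {0}) {B \<in> G. 0 \<in> B}"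
  proof (rule inj_onI)
    fix B C assume "B \<in> {B \<in> G. 0 \<in> B}" "C \<in> {B \<in> G. 0 \<in> B}" "B - {0} = C - {0}"
    then show "B = C" using insert_Diff[of 0 B] insert_Diff[of 0 C] by simp
  qed
  have cardG: "card G = card G0 + card G1"
  proof -
    have "card G1 = card {B \<in> G. 0 \<in> B}" unfolding G1_def by (rule card_image[OF inj1])
    moreover have "G = G0 \<union> {B \<in> G. 0 \<in> B}" "G0 \<inter> {B \<in> G. 0 \<in> B} = {}" by (auto simp: G0_def)
    ultimately show ?thesis using G(1) finG(1) card_Un_disjoint[of G0 "{B \<in> G. 0 \<in> B}"] by simp
  qed
  have sub0: "shadow G0 \<subseteq> G1"
  proof
    fix E assume "E \<in> shadow G0"
    then obtain B x where B: "B \<in> G" "0 \<notin> B" "x \<in> B" "E = B - {x}"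
      by (auto simp: shadow_def G0_def)
    then have "0 < x" by (metis gr0I)
    then have "insert 0 (B - {x}) \<in> G" using mem_shift_old[of x B 0 G] stable[of x] B by auto
    moreover have "E = insert 0 (B - {x}) - {0}" using B by auto
    ultimately show "E \<in> G1" unfolding G1_def by blast
  qed
  have finsh: "finite (shadow G0)" "finite (shadow G1)" "finite (shadow G)"
    by (intro finite_shadow finG G(1) finite_members[OF G0n] finite_members[OF G1n] fin; assumption)+
  have sh: "card G1 + card (shadow G1) \<le> card (shadow G)"
  proof -
    have inj: "inj_on (insert 0) (shadow G1)"
      by (rule inj_onI) (use z1 in \<open>auto simp: shadow_def insert_ident\<close>)
    have "G1 \<subseteq> shadow G" by (auto simp: shadow_def G1_def)
    moreover have "insert 0 ` shadow G1 \<subseteq> shadow G"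
    proof
      fix E assume "E \<in> insert 0 ` shadow G1"
      then obtain C x where C: "C \<in> G1" "x \<in> C" "E = insert 0 (C - {x})"
        by (auto simp: shadow_def)
      from C(1) obtain B where B: "B \<in> G" "0 \<in> B" "C = B - {0}" unfolding G1_def by blast
      have "E = B - {x}" "x \<in> B" using C(2,3) B(2,3) by blast+
      then show "E \<in> shadow G" unfolding shadow_def using B(1) by blast
    qed
    moreover have "G1 \<inter> insert 0 ` shadow G1 = {}" using z1 by blast
    ultimately have "card G1 + card (insert 0 ` shadow G1) \<le> card (shadow G)"
      using card_mono[OF finsh(3), of "G1 \<union> insert 0 ` shadow G1"]
        card_Un_disjoint[of G1 "insert 0 ` shadow G1"] finG finsh by simp
    then show ?thesis using card_image[OF inj] by simp
  qed
  have cs: "card (shadow G0) \<le> card G1" by (rule card_mono[OF finG(2) sub0])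
  have tM: "t \<le> M" using Suc.prems by simp
  have goal: "Suc t * card G \<le> (Suc M - t) * card (shadow G)"
  proof (cases t)
    case 0
    show ?thesis
    proof (cases "G = {}")
      case False
      then have "shadow G \<noteq> {}" using shadow_nonempty G(2) by blast
      then have "1 \<le> card (shadow G)" using finsh(3) by (simp add: Suc_leI card_gt_0_iff)
      then have "Suc M * 1 \<le> Suc M * card (shadow G)" by (rule mult_le_mono2)
      then show ?thesis using 0 Suc.prems(4) G(3) by simp
    qed simp
  next
    case (Suc s)
    have pas: "Suc t * (Suc M choose Suc t) = Suc M * (M choose t)"
      using Suc_times_binomial_eq[of M t] by (simp add: mult.commute)
    have big: "Suc t * card G \<le> Suc M * (M choose t)"
      using mult_le_mono2[OF Suc.prems(4), of "Suc t"] G(3) pas by simp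
    show ?thesis
    proof (cases "card G1 \<le> M choose t")
      case True
      have IH1: "t * card G1 \<le> (M - s) * card (shadow G1)"
        using Suc.IH[of G1 s] finG G1n True tM \<open>t = Suc s\<close> by simp
      have Ms: "M - s = Suc M - t" using Suc by simp
      have "(Suc M - t) * card G1 + t * card G1 \<le> (Suc M - t) * card (shadow G)"
        using IH1 mult_le_mono2[OF sh, of "Suc M - t"] unfolding Ms by (simp add: algebra_simps)
      then have A: "Suc M * card G1 \<le> (Suc M - t) * card (shadow G)"
        using tM add_mult_distrib[of "Suc M - t" t "card G1"] by simp
      \<comment> \<open>If this failed, \<open>G0\<close> would hold more than the fraction
        (M-t)/(M+1) of \<open>G\<close>. By induction, for \<open>G0\<close> itself or for a
        subfamily of size \<open>M choose Suc t\<close>, its shadow would be too large to fit into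
        \<open>G1\<close>.\<close>
      have "Suc t * card G \<le> Suc M * card G1"
      proof (rule ccontr)
        assume "\<not> ?thesis"
        then have less: "Suc M * card G1 < Suc t * card G" by simp
        have less0: "(M - t) * card G < Suc M * card G0"
        proof -
          have "Suc M * card G = Suc M * card G0 + Suc M * card G1" using cardG by (simp add: algebra_simps)
          moreover have "Suc M * card G = (M - t) * card G + Suc t * card G"
            using tM add_mult_distrib[of "M - t" "Suc t" "card G"] by simp
          ultimately show ?thesis using less by linarith
        qed
        show False
        proof (cases "card G0 \<le> M choose Suc t")
          case True
          show False
          proof (cases "t = M")
            case True
            then have "card G0 = 0" using \<open>card G0 \<le> _\<close> by (simp add: binomial_eq_0)
            then show False using less0 by simp
          next
            case False
            then have "Suc t * card G0 \<le> (M - t) * card (shadow G0)"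
              using Suc.IH[of G0 t] finG G0n True tM by simp
            also have "\<dots> \<le> (M - t) * card G1" by (rule mult_le_mono2[OF cs])
            finally have 1: "Suc t * card G0 \<le> (M - t) * card G1" .
            have "(M - t) * (Suc M * card G1) < (M - t) * (Suc t * card G)"
              using less False tM by simp
            also have "\<dots> = Suc t * ((M - t) * card G)" by (simp only: ac_simps)
            also have "\<dots> < Suc t * (Suc M * card G0)" by (rule mult_strict_left_mono[OF less0]) simp
            also have "\<dots> = Suc M * (Suc t * card G0)" by (simp only: ac_simps)
            also have "\<dots> \<le> Suc M * ((M - t) * card G1)" using 1 by (rule mult_le_mono2)
            also have "\<dots> = (M - t) * (Suc M * card G1)" by (simp only: ac_simps)
            finally show False by simp
          qed
        next
          case False
          then obtain H where H: "H \<subseteq> G0" "card H = M choose Suc t"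
            using obtain_subfamily[of "M choose Suc t" G0] by auto
          have fH: "finite H" "H \<subseteq> nsets UNIV (Suc t)" using H finG G0n finite_subset by auto
          have "M choose t \<le> card G1"
          proof (cases "t = M")
            case True
            have "G0 \<noteq> {}" using False by auto
            then have "shadow G0 \<noteq> {}" using shadow_nonempty G0n by blast
            then have "1 \<le> card (shadow G0)" using finsh by (simp add: Suc_leI card_gt_0_iff)
            then show ?thesis using True cs by simp
          next
            case False
            then have lt: "Suc t \<le> M" using tM by simp
            then have "Suc t * (M choose Suc t) \<le> (M - t) * card (shadow H)"
              using Suc.IH[of H t] fH H by simp
            moreover have "card (shadow H) \<le> card G1"
              using card_mono[OF finsh(1) shadow_mono[OF H(1)]] cs by simp
            moreover have "Suc t * (M choose Suc t) = (M - t) * (M choose t)"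
              using binomial_succ_ratio lt by simp
            ultimately have "(M - t) * (M choose t) \<le> (M - t) * card G1"
              using mult_le_mono2[of "card (shadow H)" "card G1" "M - t"] by linarith
            then show ?thesis using lt by simp
          qed
          then have "Suc M * (M choose t) \<le> Suc M * card G1" by (rule mult_le_mono2)
          then show False using less big by linarith
        qed
      qed
      then show ?thesis using A by linarith
    next
      case False
      \<comment> \<open>A subfamily of the largest size that the induction admits already has a
        shadow big enough to reach the absolute bound \<open>big\<close>.\<close>
      then obtain H where H: "H \<subseteq> G1" "card H = M choose t"
        using obtain_subfamily[of "M choose t" G1] by auto
      have fH: "finite H" "H \<subseteq> nsets UNIV (Suc s)" using H finG G1n finite_subset Suc by auto
      have IH: "t * (M choose t) \<le> (M - s) * card (shadow H)"
        using Suc.IH[of H s] fH H tM Suc by simp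
      have "card (shadow H) \<le> card (shadow G1)"
        by (rule card_mono[OF finsh(2) shadow_mono[OF H(1)]])
      then have "card (shadow H) + (M choose t) \<le> card (shadow G)" using sh False by simp
      then have "(M - s) * card (shadow H) + (M - s) * (M choose t) \<le> (M - s) * card (shadow G)"
        using mult_le_mono2[of _ _ "M - s"] by (simp only: add_mult_distrib2 [symmetric])
      then have "(t + (M - s)) * (M choose t) \<le> (M - s) * card (shadow G)"
        using IH by (simp add: add_mult_distrib)
      moreover have "t + (M - s) = Suc M" "M - s = Suc M - t" using Suc tM by auto
      ultimately show ?thesis using big by simp
    qed
  qed
  then have "Suc t * card F \<le> (Suc M - t) * card (shadow G)" using G(3) by simp
  also have "\<dots> \<le> (Suc M - t) * card (shadow F)" by (rule mult_le_mono2[OF G(4)])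
  finally show ?case .
qed

section \<open>Iterated shadows and cross-intersecting families\<close>

definition lower_shadow :: "nat \<Rightarrow> nat set set \<Rightarrow> nat set set" where
  "lower_shadow a F = {S. card S = a \<and> (\<exists>B\<in>F. finite B \<and> S \<subseteq> B)}"

text \<open>Iterate the one-step bound, which says that the density relative to an
  \<open>M\<close>-set does not drop. If an intermediate shadow outgrows \<open>M choose t\<close>,
  a subfamily of exactly that size already has \<open>M choose a\<close> sets below it.\<close>

theorem kruskal_katona:
  assumes "finite F" "F \<subseteq> nsets UNIV t" "a \<le> t" "t \<le> M" "card F \<le> M choose t"
  shows "card F * (M choose a) \<le> card (lower_shadow a F) * (M choose t)"
  using assms(3,1,2,4,5)
proof (induction t arbitrary: F rule: dec_induct)
  case base
  have "lower_shadow a F = F"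
  proof (intro equalityI subsetI)
    fix S assume "S \<in> lower_shadow a F"
    then obtain B where B: "B \<in> F" "finite B" "S \<subseteq> B" "card S = a"
      unfolding lower_shadow_def by blast
    have "card B = a" using B(1) base.prems(2) by (auto simp: nsets_def)
    then have "S = B" using card_subset_eq[OF B(2,3)] B(4) by simp
    then show "S \<in> F" using B(1) by simp
  next
    fix B assume "B \<in> F"
    then show "B \<in> lower_shadow a F" using base.prems(2) by (auto simp: lower_shadow_def nsets_def)
  qed
  then show ?case by simp
next
  case (step t)
  have fin: "\<And>B. B \<in> F \<Longrightarrow> finite B" using step.prems finite_members by blast
  have fsh: "finite (shadow F)" using finite_shadow step.prems(1) fin by blast
  have nsh: "shadow F \<subseteq> nsets UNIV t" using shadow_nsets step.prems by blast
  have flow: "finite (lower_shadow a F)"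
  proof (rule finite_subset)
    show "lower_shadow a F \<subseteq> (\<Union>B\<in>F. Pow B)" by (auto simp: lower_shadow_def)
  qed (use step.prems fin in auto)
  have sub: "lower_shadow a G \<subseteq> lower_shadow a F" if GF: "G \<subseteq> shadow F" for G
  proof
    fix S assume "S \<in> lower_shadow a G"
    then obtain B where B: "B \<in> G" "S \<subseteq> B" "card S = a" unfolding lower_shadow_def by blast
    then obtain C x where "C \<in> F" "B = C - {x}" using GF unfolding shadow_def by blast
    then show "S \<in> lower_shadow a F" using B(2,3) fin unfolding lower_shadow_def by blast
  qed
  have kk: "Suc t * card F \<le> (M - t) * card (shadow F)"
    using kruskal_katona_shadow step.prems by blast
  have tM: "t < M" using step.prems by simp
  show ?case
  proof (cases "card (shadow F) \<le> M choose t")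
    case True
    have IH: "card (shadow F) * (M choose a) \<le> card (lower_shadow a F) * (M choose t)"
      using step.IH[OF fsh nsh _ True] tM card_mono[OF flow sub[OF subset_refl]]
      by (meson le_trans less_imp_le mult_le_mono1)
    have "Suc t * (card F * (M choose a)) \<le> (M - t) * card (shadow F) * (M choose a)"
      using mult_le_mono1[OF kk, of "M choose a"] by (simp only: mult.assoc)
    also have "\<dots> \<le> (M - t) * (card (lower_shadow a F) * (M choose t))"
      using mult_le_mono2[OF IH, of "M - t"] by (simp only: mult.assoc)
    also have "\<dots> = card (lower_shadow a F) * ((M - t) * (M choose t))" by (simp only: ac_simps)
    also have "\<dots> = Suc t * (card (lower_shadow a F) * (M choose Suc t))"
      unfolding binomial_succ_ratio[OF tM, symmetric] by (simp only: ac_simps)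
    finally show ?thesis by (simp only: mult_le_cancel1)
  next
    case False
    then obtain H where H: "H \<subseteq> shadow F" "card H = M choose t"
      using obtain_subfamily[of "M choose t" "shadow F"] by auto
    have "(M choose t) * (M choose a) \<le> card (lower_shadow a H) * (M choose t)"
      using step.IH[of H] H(2) finite_subset[OF H(1) fsh] subset_trans[OF H(1) nsh] tM by simp
    moreover have "0 < M choose t" using tM by simp
    ultimately have "M choose a \<le> card (lower_shadow a H)" by (simp add: mult.commute)
    also have "\<dots> \<le> card (lower_shadow a F)" by (rule card_mono[OF flow sub[OF H(1)]])
    finally have "M choose a \<le> card (lower_shadow a F)" .
    from mult_le_mono[OF step.prems(4) this] show ?thesis by (simp only: mult.commute)
  qed
qed

text \<open>The number of \<open>b\<close>-subsets of an \<open>N\<close>-set that contain \<open>m\<close> given points; the case distinction guards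
  against truncated subtraction.\<close>

definition star_binom :: "nat \<Rightarrow> nat \<Rightarrow> nat \<Rightarrow> nat" where
  "star_binom N b m = (if m \<le> b then (N - m) choose (b - m) else 0)"

text \<open>An \<open>a\<close>-set inside the complement of a member of \<open>B\<close> misses
  that member, so it is not in \<open>A\<close>. Thus the lower shadow of the complements of
  \<open>B\<close> has at most \<open>(N choose a) - card A\<close> sets, and Kruskal-Katona with
  \<open>M = N - m\<close> applies, where \<open>star_binom N b m\<close> is the number of
  \<open>(N - b)\<close>-sets in an \<open>(N - m)\<close>-set. By \<open>small\<close> this lower
  shadow is too small for \<open>B\<close> to exceed that number; if \<open>m > b\<close>, even one
  member of \<open>B\<close> would exclude too many sets from \<open>A\<close>.\<close>

theorem cross_intersecting_bound:
  fixes V :: "nat set"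
  assumes "finite V" "card V = N" "A \<subseteq> nsets V a" "B \<subseteq> nsets V b" "a + b \<le> N" "m \<le> N"
    and cross: "\<And>S T. S \<in> A \<Longrightarrow> T \<in> B \<Longrightarrow> S \<inter> T \<noteq> {}"
    and small: "N choose a < card A + (N - m choose a)"
  shows "card B * (N - m choose a) \<le> star_binom N b m * ((N choose a) - card A)"
proof -
  have fV: "finite (nsets V a)" "finite (nsets V b)" using assms(1) finite_imp_finite_nsets by auto
  have fA: "finite A" "finite B" using fV assms(3,4) finite_subset by auto
  have cV: "card (nsets V a) = N choose a" using assms(1,2) by simp
  have cA: "card A \<le> N choose a" using card_mono[OF fV(1) assms(3)] cV by simp
  have disj: "card X \<le> (N choose a) - card A" if "X \<subseteq> nsets V a" "X \<inter> A = {}" for X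
  proof -
    have "card X + card A \<le> N choose a"
      using card_Un_disjoint[of X A] card_mono[OF fV(1), of "X \<union> A"] that assms(3) fA
        finite_subset[OF that(1) fV(1)] cV by auto
    then show ?thesis by simp
  qed
  show ?thesis
  proof (cases "m \<le> b")
    case False
    have "B = {}"
    proof (rule ccontr)
      assume "B \<noteq> {}"
      then obtain S where S: "S \<in> B" by blast
      then have cS: "S \<subseteq> V" "card S = b" "finite S" using assms(4) by (auto simp: nsets_def)
      have "card (nsets (V - S) a) = N - b choose a"
        using cS assms(1,2) by (simp add: card_Diff_subset)
      moreover have "nsets (V - S) a \<inter> A = {}" using cross[OF _ S] by (auto simp: nsets_def)
      moreover have "nsets (V - S) a \<subseteq> nsets V a" by (auto simp: nsets_def)
      ultimately have "N - b choose a \<le> (N choose a) - card A" using disj by metis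
      moreover have "N - m choose a \<le> N - b choose a" using False by (intro binomial_right_mono) simp
      ultimately show False using small cA by linarith
    qed
    then show ?thesis by simp
  next
    case True
    define F where "F = (\<lambda>S. V - S) ` B"
    have inj: "inj_on (\<lambda>S. V - S) B"
      by (rule inj_onI) (use assms(4) in \<open>auto simp: nsets_def\<close>)
    have cF: "card F = card B" unfolding F_def by (rule card_image[OF inj])
    have F: "finite F" "F \<subseteq> nsets UNIV (N - b)"
      using fA assms(1,2,4) by (auto simp: F_def nsets_def card_Diff_subset)
    have low: "card (lower_shadow a G) \<le> (N choose a) - card A" if GF: "G \<subseteq> F" for G
    proof (rule disj)
      show "lower_shadow a G \<subseteq> nsets V a"
        using that assms(1) by (auto simp: lower_shadow_def F_def nsets_def dest: finite_subset)
      show "lower_shadow a G \<inter> A = {}"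
      proof (rule ccontr)
        assume "\<not> ?thesis"
        then obtain S B' where "S \<in> A" "B' \<in> G" "S \<subseteq> B'" unfolding lower_shadow_def by blast
        moreover then obtain T where "T \<in> B" "B' = V - T" using GF unfolding F_def by blast
        ultimately show False using cross[of S T] by blast
      qed
    qed
    have sym: "N - m choose (N - b) = star_binom N b m"
      using True assms(5) binomial_symmetric[of "b - m" "N - m"] by (simp add: star_binom_def)
    have aN: "a \<le> N - b" "N - b \<le> N - m" using True assms(5) by auto
    show ?thesis
    proof (cases "card B \<le> star_binom N b m")
      case le: True
      have "card F * (N - m choose a) \<le> card (lower_shadow a F) * (N - m choose (N - b))"
        by (rule kruskal_katona[OF F aN]) (simp add: cF sym le)
      also have "\<dots> \<le> ((N choose a) - card A) * star_binom N b m"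
        unfolding sym by (rule mult_le_mono1[OF low]) simp
      finally show ?thesis by (simp add: cF mult.commute)
    next
      case False
      then obtain H where H: "H \<subseteq> F" "card H = N - m choose (N - b)"
        using obtain_subfamily[of "star_binom N b m" F] cF sym by auto
      have "card H * (N - m choose a) \<le> card (lower_shadow a H) * (N - m choose (N - b))"
        using kruskal_katona[OF _ _ aN, of H] H F finite_subset by auto
      moreover have "0 < N - m choose (N - b)" using aN by simp
      ultimately have "N - m choose a \<le> card (lower_shadow a H)" by (simp add: H mult.commute)
      also have "\<dots> \<le> (N choose a) - card A" by (rule low[OF H(1)])
      finally show ?thesis using small cA by linarith
    qed
  qed
qed

text \<open>Each of \<open>m\<close> Pascal steps loses at most the number of \<open>a\<close>-sets
  through one point. This turns a lower bound on a family into the hypothesis \<open>small\<close>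
  of the cross-intersecting bound.\<close>

lemma binomial_drop:
  "m \<le> N \<Longrightarrow> N choose a \<le> (N - m choose a) + m * star_binom N a 1"
proof (induction m)
  case (Suc m)
  have "N - m choose a \<le> (N - Suc m choose a) + star_binom N a 1"
  proof (cases a)
    case (Suc b)
    have "N - m = Suc (N - Suc m)" using \<open>Suc m \<le> N\<close> by simp
    then have "N - m choose a = (N - Suc m choose b) + (N - Suc m choose a)" by (simp add: Suc)
    moreover have "N - Suc m choose b \<le> N - 1 choose b" by (rule binomial_right_mono) simp
    ultimately show ?thesis by (simp add: Suc star_binom_def)
  qed simp
  then show ?case using Suc by simp
qed simp

section \<open>Compressed families\<close>

text \<open>As a lattice path with an up-step at each element of \<open>S\<close> and a down-step at each other element of
  \<open>V\<close>, \<open>S\<close> is counted here iff its path reaches height \<open>a\<close>; the bound below is the reflection principle.\<close>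

definition hitting :: "nat set \<Rightarrow> nat \<Rightarrow> nat \<Rightarrow> nat set set" where
  "hitting V k a = {S \<in> nsets V k. \<exists>z. card (V \<inter> {..z}) + a \<le> 2 * card (S \<inter> {..z})}"

lemma finite_hitting: "finite V \<Longrightarrow> finite (hitting V k a)"
  using finite_imp_finite_nsets[of V k] by (simp add: hitting_def)

text \<open>Induction on the first step of the path: after an up-step \<open>k - 1\<close> elements
  must gain height \<open>a - 1\<close>, after a down-step \<open>k\<close> elements must gain
  \<open>a + 1\<close>. The two bounds add up by Pascal's rule, which replaces an explicit
  reflection.\<close>

lemma card_hitting:
  assumes "finite V"
  shows "card (hitting V k a) \<le> (if a \<le> k then card V choose (k - a) else 0)"
  using assms
proof (induction "card V" arbitrary: V k a)
  case 0
  then have V: "V = {}" by simp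
  show ?case
  proof (cases "a = 0 \<and> k = 0")
    case True
    then have "hitting V k a \<subseteq> {{}}" using V by (auto simp: hitting_def nsets_def)
    from card_mono[OF _ this] show ?thesis using True by simp
  next
    case False
    then have "hitting V k a = {}" using V by (auto simp: hitting_def nsets_def)
    then show ?thesis by simp
  qed
next
  case (Suc N)
  show ?case
  proof (cases "a = 0")
    case True
    have "card (hitting V k a) \<le> card (nsets V k)"
      by (rule card_mono) (use Suc.prems finite_imp_finite_nsets in \<open>auto simp: hitting_def\<close>)
    then show ?thesis using True Suc.prems by simp
  next
    case False
    define v where "v = Min V"
    define W where "W = V - {v}"
    have ne: "V \<noteq> {}" using Suc by auto
    have vV: "v \<in> V" unfolding v_def using Suc.prems ne by simp
    have vmin: "\<And>x. x \<in> V \<Longrightarrow> v \<le> x" unfolding v_def using Suc.prems by simp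
    have W: "finite W" "card W = N" using Suc vV by (auto simp: W_def)
    have fin: "finite S" if "S \<subseteq> V" for S using that Suc.prems finite_subset by blast
    have sub: "hitting V k a \<subseteq> (if k = 0 then {} else insert v ` hitting W (k - 1) (a - 1)) \<union> hitting W k (a + 1)"
    proof
      fix S assume "S \<in> hitting V k a"
      then obtain z where S: "S \<subseteq> V" "card S = k" "card (V \<inter> {..z}) + a \<le> 2 * card (S \<inter> {..z})"
        by (auto simp: hitting_def nsets_def)
      have vz: "v \<le> z"
      proof (rule ccontr)
        assume "\<not> v \<le> z"
        then have "\<not> x \<le> z" if "x \<in> S" for x using vmin[of x] S(1) that by auto
        then have "S \<inter> {..z} = {}" by auto
        then show False using S(3) False by simp
      qed
      have "V \<inter> {..z} = insert v (W \<inter> {..z})" using vz vV by (auto simp: W_def)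
      then have cV: "card (V \<inter> {..z}) = Suc (card (W \<inter> {..z}))" using W(1) by (simp add: W_def)
      show "S \<in> (if k = 0 then {} else insert v ` hitting W (k - 1) (a - 1)) \<union> hitting W k (a + 1)"
      proof (cases "v \<in> S")
        case True
        have "S \<inter> {..z} = insert v ((S - {v}) \<inter> {..z})" using vz True by auto
        then have "card (S \<inter> {..z}) = Suc (card ((S - {v}) \<inter> {..z}))"
          using fin[OF S(1)] by simp
        then have "card (W \<inter> {..z}) + (a - 1) \<le> 2 * card ((S - {v}) \<inter> {..z})"
          using S(3) cV False by simp
        moreover have "S - {v} \<in> nsets W (k - 1)"
          using S True fin[OF S(1)] by (auto simp: nsets_def W_def)
        ultimately have "S - {v} \<in> hitting W (k - 1) (a - 1)" by (auto simp: hitting_def)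
        then have "S \<in> insert v ` hitting W (k - 1) (a - 1)"
          by (rule image_eqI[rotated]) (use True in auto)
        moreover have "k \<noteq> 0" using S(2) True fin[OF S(1)] card_gt_0_iff[of S] by auto
        ultimately show ?thesis by auto
      next
        case False
        then have "S \<in> nsets W k" using S fin[OF S(1)] by (auto simp: nsets_def W_def)
        then show ?thesis using S(3) cV by (auto simp: hitting_def)
      qed
    qed
    have "card (hitting V k a) \<le> card ((if k = 0 then {} else insert v ` hitting W (k - 1) (a - 1)) \<union> hitting W k (a + 1))"
      by (rule card_mono[OF _ sub]) (simp add: finite_hitting W)
    also have "\<dots> \<le> card (if k = 0 then {} else insert v ` hitting W (k - 1) (a - 1)) + card (hitting W k (a + 1))"
      by (rule card_Un_le)
    also have "\<dots> \<le> (if k = 0 then 0 else card (hitting W (k - 1) (a - 1))) + card (hitting W k (a + 1))"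
      using card_image_le[OF finite_hitting[OF W(1)], of "insert v"] by simp
    also have "\<dots> \<le> (if a \<le> k then N choose (k - a) else 0) + (if a + 1 \<le> k then N choose (k - (a + 1)) else 0)"
    proof (rule add_mono)
      show "(if k = 0 then 0 else card (hitting W (k - 1) (a - 1))) \<le> (if a \<le> k then N choose (k - a) else 0)"
      proof (cases "k = 0")
        case k: False
        have "a - 1 \<le> k - 1 \<longleftrightarrow> a \<le> k" "k - 1 - (a - 1) = k - a" using False k by auto
        with Suc.hyps(1)[OF W(2)[symmetric] W(1), of "k - 1" "a - 1"] k show ?thesis
          unfolding W(2) by (simp only: if_False)
      qed simp
      show "card (hitting W k (a + 1)) \<le> (if a + 1 \<le> k then N choose (k - (a + 1)) else 0)"
        using Suc.hyps(1)[OF W(2)[symmetric] W(1), of k "a + 1"] unfolding W(2) .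
    qed
    also have "\<dots> = (if a \<le> k then card V choose (k - a) else 0)"
    proof (cases "a < k")
      case True
      then have "k - a = Suc (k - (a + 1))" by simp
      then show ?thesis using True Suc.hyps(2)[symmetric] by simp
    next
      case False
      then show ?thesis by (cases "a = k") auto
    qed
    finally show ?thesis .
  qed
qed

text \<open>The least element \<open>j\<close> of \<open>B\<close> in \<open>V\<close> outside
  \<open>D\<close> can be traded for a smaller one: all earlier elements of \<open>B\<close> in
  \<open>V\<close> lie in \<open>D\<close>, so the prefix condition at \<open>j\<close> leaves some
  \<open>i < j\<close> in \<open>D\<close> but not in \<open>B\<close>. Stability keeps the new set
  in \<open>G\<close>, and it still satisfies the prefix condition.\<close>

lemma stable_dominated:
  assumes "finite V" and stable: "\<And>i j. i \<in> V \<Longrightarrow> j \<in> V \<Longrightarrow> i < j \<Longrightarrow> shift i j G = G"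
    and "B \<in> G" "D \<subseteq> V" "\<And>z. card (B \<inter> V \<inter> {..z}) \<le> card (D \<inter> {..z})"
  shows "\<exists>C\<in>G. C \<inter> V \<subseteq> D \<and> C - V = B - V"
  using assms(3,5)
proof (induction "card (B \<inter> V - D)" arbitrary: B rule: less_induct)
  case less
  show ?case
  proof (cases "B \<inter> V \<subseteq> D")
    case False
    define j where "j = Min (B \<inter> V - D)"
    have fin: "finite (B \<inter> V)" "finite D" using assms(1) finite_subset[OF assms(4,1)] by auto
    have j: "j \<in> B" "j \<in> V" "j \<notin> D"
      using Min_in[of "B \<inter> V - D"] False fin by (auto simp: j_def)
    have jmin: "x \<in> D" if "x \<in> B" "x \<in> V" "x < j" for x
    proof (rule ccontr)
      assume "x \<notin> D"
      then have "j \<le> x" unfolding j_def using that fin by (intro Min_le) auto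
      then show False using that by simp
    qed
    have "\<exists>i\<in>D. i < j \<and> i \<notin> B"
    proof (rule ccontr)
      assume "\<not> ?thesis"
      then have "insert j (D \<inter> {..j}) \<subseteq> B \<inter> V \<inter> {..j}"
        using j assms(4) by (auto simp: le_less)
      then have "card (insert j (D \<inter> {..j})) \<le> card (B \<inter> V \<inter> {..j})"
        using fin by (intro card_mono) auto
      then show False using less.prems(2)[of j] j fin by simp
    qed
    then obtain i where i: "i \<in> D" "i < j" "i \<notin> B" by blast
    define B' where "B' = insert i (B - {j})"
    have iV: "i \<in> V" using i assms(4) by blast
    have B': "B' \<in> G"
      using mem_shift_old[of j B i G] stable[OF iV j(2) i(2)] j(1) i(3) less.prems(1) by (simp add: B'_def)
    have "B' \<inter> V - D = (B \<inter> V - D) - {j}" using i iV by (auto simp: B'_def)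
    then have dec: "card (B' \<inter> V - D) < card (B \<inter> V - D)"
      using j fin card_Diff1_less[of "B \<inter> V - D" j] by simp
    have dom: "card (B' \<inter> V \<inter> {..z}) \<le> card (D \<inter> {..z})" for z
    proof (cases "z < j")
      case True
      then have "B' \<inter> V \<inter> {..z} \<subseteq> D \<inter> {..z}" using jmin i by (auto simp: B'_def)
      then show ?thesis using fin by (intro card_mono) auto
    next
      case False
      then have "B' \<inter> V \<inter> {..z} = insert i (B \<inter> V \<inter> {..z} - {j})"
        using i iV by (auto simp: B'_def)
      moreover have "card (insert i (B \<inter> V \<inter> {..z} - {j})) = card (B \<inter> V \<inter> {..z})"
        using card.remove[of "B \<inter> V \<inter> {..z}" j] fin i j False by simp
      ultimately show ?thesis using less.prems(2)[of z] by simp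
    qed
    have "B' - V = B - V" using j iV by (auto simp: B'_def)
    then show ?thesis using less.hyps[OF dec B' dom] by simp
  qed (use less.prems in blast)
qed

text \<open>If the lattice paths of \<open>B\<close> and \<open>C\<close> on \<open>V\<close> never
  rise above 0, then \<open>V - C\<close> dominates \<open>B\<close>. So \<open>B\<close> can be
  pushed off \<open>C\<close> inside \<open>V\<close> without change outside \<open>V\<close>, and
  the intersection must come from outside.\<close>

lemma stable_balanced_meet:
  assumes "finite V" and stable: "\<And>i j. i \<in> V \<Longrightarrow> j \<in> V \<Longrightarrow> i < j \<Longrightarrow> shift i j G = G"
    and "intersecting G" "B \<in> G" "C \<in> G"
    and B: "\<And>z. 2 * card (B \<inter> V \<inter> {..z}) \<le> card (V \<inter> {..z})"
    and C: "\<And>z. 2 * card (C \<inter> V \<inter> {..z}) \<le> card (V \<inter> {..z})"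
  shows "(B - V) \<inter> (C - V) \<noteq> {}"
proof
  assume dis: "(B - V) \<inter> (C - V) = {}"
  have "card (B \<inter> V \<inter> {..z}) \<le> card ((V - C) \<inter> {..z})" for z
  proof -
    have "(V - C) \<inter> {..z} = V \<inter> {..z} - C \<inter> V \<inter> {..z}" by auto
    moreover have "card (V \<inter> {..z} - C \<inter> V \<inter> {..z}) = card (V \<inter> {..z}) - card (C \<inter> V \<inter> {..z})"
      using assms(1) by (intro card_Diff_subset) auto
    ultimately show ?thesis using B[of z] C[of z] by simp
  qed
  then obtain D where "D \<in> G" "D \<inter> V \<subseteq> V - C" "D - V = B - V"
    using stable_dominated[OF assms(1) stable assms(4), of "V - C"] by blast
  then have "D \<inter> C = {}" using dis by blast
  then show False using assms(3,5) \<open>D \<in> G\<close> by (auto simp: intersecting_def)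
qed

text \<open>For \<open>Y = {x}\<close> this is the degree of \<open>x\<close> (with
  \<open>T = {x}\<close>) or the number of members avoiding \<open>x\<close> (with
  \<open>T = {}\<close>).\<close>

definition trace_card :: "nat set set \<Rightarrow> nat set \<Rightarrow> nat set \<Rightarrow> nat" where
  "trace_card G Y T = card {B \<in> G. B \<inter> Y = T}"

lemma trace_card_split:
  assumes "finite G" "w \<notin> Y" "T \<subseteq> Y"
  shows "trace_card G Y T = trace_card G (insert w Y) T + trace_card G (insert w Y) (insert w T)"
proof -
  have "{B \<in> G. B \<inter> Y = T} = {B \<in> G. B \<inter> insert w Y = T} \<union> {B \<in> G. B \<inter> insert w Y = insert w T}"
    using assms(2,3) by auto
  moreover have "card ({B \<in> G. B \<inter> insert w Y = T} \<union> {B \<in> G. B \<inter> insert w Y = insert w T}) =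
      trace_card G (insert w Y) T + trace_card G (insert w Y) (insert w T)"
    unfolding trace_card_def by (rule card_Un_disjoint) (use assms in auto)
  ultimately show ?thesis by (simp add: trace_card_def)
qed

lemma trace_filter_shift:
  assumes "i \<notin> Y" "j \<notin> Y"
  shows "{B \<in> shift i j G. B \<inter> Y = T} = shift i j {B \<in> G. B \<inter> Y = T}"
proof (rule shift_filter)
  fix B
  have "swap_in i j B \<inter> Y = B \<inter> Y" using assms by (auto simp: swap_in_def)
  then show "(swap_in i j B \<inter> Y = T) = (B \<inter> Y = T)" by simp
qed

lemma trace_card_shift:
  assumes "i \<notin> Y" "j \<notin> Y"
  shows "trace_card (shift i j G) Y T = trace_card G Y T"
  unfolding trace_card_def trace_filter_shift[OF assms] by (rule card_shift)

text \<open>Only \<open>i\<close> can gain degree, and only through images of members containing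
  \<open>j\<close>. So one compression at most doubles a common upper bound on the degrees; the
  later arguments rely on gaps in the possible degrees that such a jump cannot cross.\<close>

lemma trace_card_shift_degree:
  assumes "finite G" "i \<notin> Y" "j \<notin> Y" "w \<notin> Y" "T \<subseteq> Y"
  shows "trace_card (shift i j G) (insert w Y) (insert w T) \<le>
    trace_card G (insert w Y) (insert w T) +
    (if w = i then trace_card G (insert j Y) (insert j T) else 0)"
proof -
  define H where "H = {B \<in> G. B \<inter> Y = T}"
  have fH: "finite H" using assms(1) by (simp add: H_def)
  have deg: "{B \<in> F. B \<inter> insert x Y = insert x T} = {B \<in> {B \<in> F. B \<inter> Y = T}. x \<in> B}"
    if "x \<notin> Y" for F x using that assms(5) by auto
  have eq: "trace_card (shift i j G) (insert w Y) (insert w T) = card {B \<in> shift i j H. w \<in> B}"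
    unfolding trace_card_def deg[OF assms(4)] trace_filter_shift[OF assms(2,3)] H_def ..
  have eqG: "trace_card G (insert x Y) (insert x T) = card {B \<in> H. x \<in> B}" if "x \<notin> Y" for x
    unfolding trace_card_def deg[OF that] H_def ..
  show ?thesis
  proof (cases "w = i")
    case True
    have "{B \<in> shift i j H. w \<in> B} \<subseteq> {B \<in> H. w \<in> B} \<union> (\<lambda>B. insert i (B - {j})) ` {B \<in> H. j \<in> B}"
    proof
      fix C assume "C \<in> {B \<in> shift i j H. w \<in> B}"
      then have C: "C \<in> shift i j H" "i \<in> C" using True by auto
      from C(1) show "C \<in> {B \<in> H. w \<in> B} \<union> (\<lambda>B. insert i (B - {j})) ` {B \<in> H. j \<in> B}"
      proof (cases rule: shift_mem_cases)
        case keep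
        then show ?thesis using C True by blast
      next
        case move
        have "C = insert i (insert j (C - {i}) - {j})" using move by auto
        then show ?thesis using move by blast
      qed
    qed
    then have "card {B \<in> shift i j H. w \<in> B} \<le> card ({B \<in> H. w \<in> B} \<union> (\<lambda>B. insert i (B - {j})) ` {B \<in> H. j \<in> B})"
      using fH by (intro card_mono) auto
    also have "\<dots> \<le> card {B \<in> H. w \<in> B} + card ((\<lambda>B. insert i (B - {j})) ` {B \<in> H. j \<in> B})"
      by (rule card_Un_le)
    also have "\<dots> \<le> card {B \<in> H. w \<in> B} + card {B \<in> H. j \<in> B}"
      by (intro add_left_mono card_image_le) (simp add: fH)
    finally show ?thesis using True eq eqG assms by simp
  next
    case False
    have "card {B \<in> shift i j H. w \<in> B} \<le> card {B \<in> H. w \<in> B}"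
    proof (cases "w = j")
      case True
      have "{B \<in> shift i j H. w \<in> B} \<subseteq> {B \<in> H. w \<in> B}"
        using True by (auto elim: shift_mem_cases)
      then show ?thesis using fH by (intro card_mono) auto
    next
      case neq: False
      have "{B \<in> shift i j H. w \<in> B} = shift i j {B \<in> H. w \<in> B}"
        by (rule shift_filter) (use False neq in \<open>auto simp: swap_in_def\<close>)
      then show ?thesis by (simp add: card_shift)
    qed
    then show ?thesis using False eq eqG assms by simp
  qed
qed

text \<open>Members with disjoint traces on \<open>Y\<close> must meet outside \<open>Y\<close>, so
  their remainders are cross-intersecting there.\<close>

lemma trace_card_cross_exact:
  assumes "G \<subseteq> nsets {1..n} k" "intersecting G" "Y \<subseteq> {1..n}" "T \<subseteq> Y" "S \<subseteq> Y" "T \<inter> S = {}"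
    and "(k - card T) + (k - card S) \<le> n - card Y" "m \<le> n - card Y"
    and small: "n - card Y choose (k - card T) < trace_card G Y T + (n - card Y - m choose (k - card T))"
  shows "trace_card G Y S * (n - card Y - m choose (k - card T)) \<le>
    star_binom (n - card Y) (k - card S) m * ((n - card Y choose (k - card T)) - trace_card G Y T)"
proof -
  define fam where "fam R = (\<lambda>B. B - R) ` {B \<in> G. B \<inter> Y = R}" for R
  have fY: "finite Y" using finite_subset[OF assms(3)] by simp
  have cV: "card ({1..n} - Y) = n - card Y" using assms(3) fY by (simp add: card_Diff_subset)
  have nsets: "fam R \<subseteq> nsets ({1..n} - Y) (k - card R)" if "R \<subseteq> Y" for R
  proof
    fix E assume "E \<in> fam R"
    then obtain B where B: "B \<in> G" "B \<inter> Y = R" "E = B - R" by (auto simp: fam_def)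
    have "B \<in> nsets {1..n} k" "finite R" "R \<subseteq> B" using B assms(1) finite_subset[OF that fY] by auto
    then show "E \<in> nsets ({1..n} - Y) (k - card R)"
      using B by (auto simp: nsets_def card_Diff_subset)
  qed
  have card: "card (fam R) = trace_card G Y R" for R
    unfolding fam_def trace_card_def
  proof (rule card_image, rule inj_onI)
    fix B C assume "B \<in> {B \<in> G. B \<inter> Y = R}" "C \<in> {B \<in> G. B \<inter> Y = R}" "B - R = C - R"
    then show "B = C" by blast
  qed
  have "card (fam S) * (n - card Y - m choose (k - card T)) \<le>
    star_binom (n - card Y) (k - card S) m * ((n - card Y choose (k - card T)) - card (fam T))"
  proof (rule cross_intersecting_bound[OF _ cV nsets nsets])
    fix A B assume "A \<in> fam T" "B \<in> fam S"
    then obtain A' B' where AB: "A' \<in> G" "A' \<inter> Y = T" "A = A' - T" "B' \<in> G" "B' \<inter> Y = S" "B = B' - S"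
      by (auto simp: fam_def)
    then have "A' \<inter> B' \<noteq> {}" using assms(2) by (auto simp: intersecting_def)
    then show "A \<inter> B \<noteq> {}" using AB assms(6) by blast
  qed (use assms card in auto)
  then show ?thesis by (simp add: card)
qed

lemma trace_card_le:
  assumes "G \<subseteq> nsets {1..n} k" "Y \<subseteq> {1..n}" "T \<subseteq> Y"
  shows "trace_card G Y T \<le> n - card Y choose (k - card T)"
proof -
  have fin: "finite Y" "finite T" using finite_subset[OF assms(2)] finite_subset[OF assms(3)] by auto
  have "(\<lambda>B. B - T) ` {B \<in> G. B \<inter> Y = T} \<subseteq> nsets ({1..n} - Y) (k - card T)"
  proof
    fix E assume "E \<in> (\<lambda>B. B - T) ` {B \<in> G. B \<inter> Y = T}"
    then obtain B where B: "B \<in> G" "B \<inter> Y = T" "E = B - T" by auto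
    have "B \<in> nsets {1..n} k" "T \<subseteq> B" using B assms(1) by auto
    then show "E \<in> nsets ({1..n} - Y) (k - card T)"
      using B fin by (auto simp: nsets_def card_Diff_subset)
  qed
  moreover have "finite (nsets ({1..n} - Y) (k - card T))" by (rule finite_imp_finite_nsets) simp
  ultimately have "card ((\<lambda>B. B - T) ` {B \<in> G. B \<inter> Y = T}) \<le> card (nsets ({1..n} - Y) (k - card T))"
    by (rule card_mono[rotated])
  moreover have "inj_on (\<lambda>B. B - T) {B \<in> G. B \<inter> Y = T}"
    by (rule inj_onI) blast
  ultimately show ?thesis
    using fin assms(2) by (simp add: trace_card_def card_image card_Diff_subset)
qed

lemma trace_card_cross:
  assumes "G \<subseteq> nsets {1..n} k" "intersecting G" "Y \<subseteq> {1..n}" "T \<subseteq> Y" "S \<subseteq> Y" "T \<inter> S = {}"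
    and "(k - card T) + (k - card S) \<le> n - card Y" "m \<le> n - card Y"
    and "m * star_binom (n - card Y) (k - card T) 1 < trace_card G Y T"
  shows "trace_card G Y S \<le> star_binom (n - card Y) (k - card S) m"
proof -
  let ?C = "n - card Y choose (k - card T)" and ?D = "n - card Y - m choose (k - card T)"
  have small: "?C < trace_card G Y T + ?D"
    using binomial_drop[OF assms(8), of "k - card T"] assms(9) by linarith
  then have pos: "0 < ?D" using trace_card_le[OF assms(1,3,4)] by linarith
  have "trace_card G Y S * ?D \<le> star_binom (n - card Y) (k - card S) m * (?C - trace_card G Y T)"
    by (rule trace_card_cross_exact[OF assms(1-8) small])
  also have "\<dots> \<le> star_binom (n - card Y) (k - card S) m * ?D"
    using small by (intro mult_le_mono2) linarith
  finally show ?thesis using pos by simp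
qed

text \<open>A set avoiding the initial segment \<open>E\<close> starts with \<open>card E\<close>
  down-steps. To rise above 0 afterwards, its path must climb \<open>card E + 1\<close> on the rest;
  the reflection bound counts such sets, so a larger family contains a balanced one.\<close>

lemma balanced_member:
  assumes "G \<subseteq> nsets {1..n} k" "Y \<subseteq> {1..n}" "T \<subseteq> Y" "E \<subseteq> {1..n} - Y"
    and initial: "\<And>e x. e \<in> E \<Longrightarrow> x \<in> {1..n} - Y - E \<Longrightarrow> e < x"
    and big: "(if card E + 1 \<le> k - card T then n - card Y - card E choose (k - card T - (card E + 1)) else 0)
      < trace_card G (Y \<union> E) T"
  shows "\<exists>B\<in>G. B \<inter> Y = T \<and> (\<forall>z. 2 * card (B \<inter> ({1..n} - Y) \<inter> {..z}) \<le> card (({1..n} - Y) \<inter> {..z}))"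
proof (rule ccontr)
  assume neg: "\<not> ?thesis"
  define V where "V = {1..n} - Y"
  have fin: "finite V" "finite E" "finite Y"
    using finite_subset[OF assms(2)] finite_subset[OF assms(4)] by (auto simp: V_def)
  have "card V = n - card Y" using fin assms(2) by (simp add: V_def card_Diff_subset)
  then have cVE: "card (V - E) = n - card Y - card E"
    using card_Diff_subset[OF fin(2), of V] assms(4) by (simp add: V_def)
  have inj: "inj_on (\<lambda>B. B - T) {B \<in> G. B \<inter> (Y \<union> E) = T}"
    by (rule inj_onI) blast
  have sub: "(\<lambda>B. B - T) ` {B \<in> G. B \<inter> (Y \<union> E) = T} \<subseteq> hitting (V - E) (k - card T) (card E + 1)"
  proof
    fix S assume "S \<in> (\<lambda>B. B - T) ` {B \<in> G. B \<inter> (Y \<union> E) = T}"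
    then obtain B where B: "B \<in> G" "B \<inter> (Y \<union> E) = T" "S = B - T" by auto
    have BY: "B \<inter> Y = T" using B(2) assms(3,4) by auto
    have Bn: "B \<subseteq> {1..n}" "finite B" "card B = k" using B(1) assms(1) by (auto simp: nsets_def)
    obtain z where z: "card (V \<inter> {..z}) < 2 * card (B \<inter> V \<inter> {..z})"
      using neg B(1) BY by (auto simp: V_def not_le)
    have BV: "B \<inter> V = S" using B BY Bn(1) by (auto simp: V_def)
    have SE: "S \<subseteq> V - E" using B BV assms(3,4) by (auto simp: V_def)
    have "card (S \<inter> {..z}) \<noteq> 0" using z BV by auto
    then obtain x where x: "x \<in> S" "x \<le> z" by (auto simp: card_eq_0_iff)
    have "E \<subseteq> {..z}"
    proof
      fix e assume "e \<in> E"
      then have "e < x" using initial x(1) SE unfolding V_def by blast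
      then show "e \<in> {..z}" using x(2) by simp
    qed
    then have "V \<inter> {..z} = E \<union> ((V - E) \<inter> {..z})" using assms(4) by (auto simp: V_def)
    moreover have "card (E \<union> ((V - E) \<inter> {..z})) = card E + card ((V - E) \<inter> {..z})"
      by (rule card_Un_disjoint) (use fin in auto)
    ultimately have "card ((V - E) \<inter> {..z}) + (card E + 1) \<le> 2 * card (S \<inter> {..z})"
      using z BV by simp
    moreover have "S \<in> nsets (V - E) (k - card T)"
    proof -
      have "T \<subseteq> B" "finite T" using BY finite_subset[OF assms(3) fin(3)] by auto
      then show ?thesis using SE Bn B(3) by (simp add: nsets_def card_Diff_subset)
    qed
    ultimately show "S \<in> hitting (V - E) (k - card T) (card E + 1)" by (auto simp: hitting_def)
  qed
  have "trace_card G (Y \<union> E) T \<le> card (hitting (V - E) (k - card T) (card E + 1))"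
    unfolding trace_card_def using card_mono[OF finite_hitting sub] fin card_image[OF inj] by simp
  also have "card (hitting (V - E) (k - card T) (card E + 1)) \<le>
      (if card E + 1 \<le> k - card T then n - card Y - card E choose (k - card T - (card E + 1)) else 0)"
    unfolding cVE[symmetric] by (rule card_hitting) (use fin in simp)
  finally show False using big by simp
qed

section \<open>Vertices of large degree\<close>

lemma star_binom_antimono:
  assumes "c \<le> d" "k \<le> n"
  shows "star_binom n k d \<le> star_binom n k c"
  using assms(1)
proof (induction d rule: dec_induct)
  case (step d)
  have "star_binom n k (Suc d) \<le> star_binom n k d"
  proof (cases "Suc d \<le> k")
    case True
    then have "n - d = Suc (n - Suc d)" "k - d = Suc (k - Suc d)" using assms(2) by auto
    then show ?thesis using True by (simp add: star_binom_def)
  qed (simp add: star_binom_def)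
  then show ?case using step.IH by simp
qed simp

text \<open>Returns from the ground set without \<open>Y\<close> to the original one:
  \<open>s\<close> points of the trace and \<open>m\<close> further points are \<open>s + m\<close>
  prescribed points.\<close>

lemma star_binom_reduce:
  assumes "s \<le> y" "1 \<le> m"
  shows "star_binom (n - y) (k - s) m \<le> star_binom n k (s + m)"
proof (cases "m \<le> k - s")
  case True
  then have "s + m \<le> k" "k - s - m = k - (s + m)" using assms(2) by auto
  moreover have "n - y - m \<le> n - (s + m)" using assms(1) by simp
  ultimately show ?thesis using True by (simp add: star_binom_def binomial_right_mono)
qed (simp add: star_binom_def)

lemma trace_card_cross_le:
  assumes "G \<subseteq> nsets {1..n} k" "intersecting G" "36 * k \<le> n" "2 \<le> k"
    and "Y \<subseteq> {1..n}" "T \<subseteq> Y" "S \<subseteq> Y" "T \<inter> S = {}" "card T = 2" "card Y \<le> 3"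
    and "1 \<le> m" "m \<le> 3" "m * star_binom n k 3 < trace_card G Y T"
  shows "trace_card G Y S \<le> star_binom (n - card Y) (k - card S) m"
proof (rule trace_card_cross[OF assms(1,2,5-8)])
  have cY: "2 \<le> card Y" using card_mono[OF finite_subset[OF assms(5)] assms(6)] assms(9) by simp
  show "(k - card T) + (k - card S) \<le> n - card Y" "m \<le> n - card Y" using assms by auto
  have "star_binom (n - card Y) (k - 2) 1 \<le> star_binom n k 3"
    using star_binom_reduce[OF cY, of 1 n k] by simp
  then have "m * star_binom (n - card Y) (k - card T) 1 \<le> m * star_binom n k 3"
    using assms(9) by simp
  then show "m * star_binom (n - card Y) (k - card T) 1 < trace_card G Y T"
    using assms(13) by linarith
qed

text \<open>Write u for \<open>star_binom n k 3\<close>. A pair heavier than m u leaves at most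
  \<open>star_binom n k (card S + m)\<close> members on a disjoint trace \<open>S\<close>. To get u,
  the weight 2 u is enough against a single point, and 3 u against the empty trace.\<close>

lemma trace_card_cross_unit:
  assumes "G \<subseteq> nsets {1..n} k" "intersecting G" "36 * k \<le> n" "2 \<le> k"
    and "Y \<subseteq> {1..n}" "T \<subseteq> Y" "S \<subseteq> Y" "T \<inter> S = {}" "card T = 2" "card Y \<le> 3"
    and "1 \<le> m" "m \<le> 3" "m * star_binom n k 3 < trace_card G Y T" "3 \<le> m + card S"
  shows "trace_card G Y S \<le> star_binom n k 3"
proof -
  have "card S \<le> card Y" by (rule card_mono[OF finite_subset[OF assms(5)] assms(7)]) simp
  then have "star_binom (n - card Y) (k - card S) m \<le> star_binom n k (card S + m)"
    using star_binom_reduce assms(11) by blast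
  also have "\<dots> \<le> star_binom n k 3" by (rule star_binom_antimono) (use assms in auto)
  finally show ?thesis using trace_card_cross_le[OF assms(1-13)] by linarith
qed

lemma finite_family: "G \<subseteq> nsets {1..n::nat} k \<Longrightarrow> finite G"
  using finite_subset finite_imp_finite_nsets[of "{1..n}" k] by blast

text \<open>A self-improving bound: weight above 2 u on \<open>{w, x}\<close> forces the trace
  \<open>{y}\<close> down to u, so \<open>{w, y}\<close> gets more than 4 u, and the same argument
  returns to \<open>{w, x}\<close>. No pair weight lies between 2 u and 4 u.\<close>

lemma heavy_vertex_left:
  assumes G: "G \<subseteq> nsets {1..n} k" "intersecting G" "36 * k \<le> n" "2 \<le> k"
    and xy: "x \<in> {1..n}" "y \<in> {1..n}" "x \<noteq> y" and w: "w \<in> {1..n} - {x, y}"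
    and big: "5 * star_binom n k 3 < trace_card G {x, y} {x}" "5 * star_binom n k 3 < trace_card G {x, y} {y}"
    and heavy: "2 * star_binom n k 3 < trace_card G {w, x, y} {w, x}"
  shows "trace_card G {w, x, y} {x} \<le> star_binom n k 3"
    "trace_card G {w, x, y} {y} \<le> star_binom n k 3"
    "4 * star_binom n k 3 < trace_card G {w, x, y} {w, x}"
    "4 * star_binom n k 3 < trace_card G {w, x, y} {w, y}"
proof -
  have Y: "{w, x, y} \<subseteq> {1..n}" "card {w, x, y} \<le> 3" using xy w by auto
  have split: "trace_card G {x, y} T = trace_card G {w, x, y} T + trace_card G {w, x, y} (insert w T)"
    if "T \<subseteq> {x, y}" for T
    using trace_card_split[OF finite_family[OF G(1)] _ that] w by auto
  show y: "trace_card G {w, x, y} {y} \<le> star_binom n k 3"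
    by (rule trace_card_cross_unit[OF G Y(1) _ _ _ _ Y(2) _ _ heavy]) (use xy w in auto)
  then show wy: "4 * star_binom n k 3 < trace_card G {w, x, y} {w, y}"
    using big(2) split[of "{y}"] by simp
  have "2 * star_binom n k 3 < trace_card G {w, x, y} {w, y}" using wy by linarith
  then show x: "trace_card G {w, x, y} {x} \<le> star_binom n k 3"
    by (rule trace_card_cross_unit[OF G Y(1) _ _ _ _ Y(2), rotated -2]) (use xy w in auto)
  then show "4 * star_binom n k 3 < trace_card G {w, x, y} {w, x}"
    using big(1) split[of "{x}"] by simp
qed

lemma heavy_vertex:
  assumes G: "G \<subseteq> nsets {1..n} k" "intersecting G" "36 * k \<le> n" "2 \<le> k"
    and xy: "x \<in> {1..n}" "y \<in> {1..n}" "x \<noteq> y" and w: "w \<in> {1..n} - {x, y}"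
    and big: "5 * star_binom n k 3 < trace_card G {x, y} {x}" "5 * star_binom n k 3 < trace_card G {x, y} {y}"
    and heavy: "2 * star_binom n k 3 < trace_card G {w, x, y} {w, x} \<or>
      2 * star_binom n k 3 < trace_card G {w, x, y} {w, y}"
  shows "trace_card G {w, x, y} {x} \<le> star_binom n k 3"
    "trace_card G {w, x, y} {y} \<le> star_binom n k 3"
    "4 * star_binom n k 3 < trace_card G {w, x, y} {w, x}"
    "4 * star_binom n k 3 < trace_card G {w, x, y} {w, y}"
proof -
  have yx: "{y, x} = {x, y}" by (rule insert_commute)
  note left = heavy_vertex_left[OF G xy w big]
  note right = heavy_vertex_left[OF G xy(2,1) xy(3)[symmetric], of w, unfolded yx, OF w big(2,1)]
  show "trace_card G {w, x, y} {x} \<le> star_binom n k 3" using heavy left(1) right(2) by blast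
  show "trace_card G {w, x, y} {y} \<le> star_binom n k 3" using heavy left(2) right(1) by blast
  show "4 * star_binom n k 3 < trace_card G {w, x, y} {w, x}" using heavy left(3) right(4) by blast
  show "4 * star_binom n k 3 < trace_card G {w, x, y} {w, y}" using heavy left(4) right(3) by blast
qed

text \<open>If no \<open>w\<close> is heavy, compress all points but \<open>x\<close> and
  \<open>y\<close>. Weights of at most 2 u become at most 4 u, and the gap brings them back to 2 u.
  In the compressed family, balanced members with traces \<open>{x}\<close> and \<open>{y}\<close>
  would have to meet in \<open>{x, y}\<close>.\<close>

lemma common_vertex:
  assumes F: "F \<subseteq> nsets {1..n} k" "intersecting F" and nk: "36 * k \<le> n" "2 \<le> k"
    and xy: "x \<in> {1..n}" "y \<in> {1..n}" "x \<noteq> y"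
    and big: "5 * star_binom n k 3 < trace_card F {x, y} {x}" "5 * star_binom n k 3 < trace_card F {x, y} {y}"
  obtains w where "w \<in> {1..n} - {x, y}"
    "trace_card F {w, x, y} {x} \<le> star_binom n k 3"
    "trace_card F {w, x, y} {y} \<le> star_binom n k 3"
    "4 * star_binom n k 3 < trace_card F {w, x, y} {w, x}"
    "4 * star_binom n k 3 < trace_card F {w, x, y} {w, y}"
proof (cases "\<exists>w\<in>{1..n} - {x, y}. 2 * star_binom n k 3 < trace_card F {w, x, y} {w, x} \<or>
    2 * star_binom n k 3 < trace_card F {w, x, y} {w, y}")
  case True
  then obtain w where w: "w \<in> {1..n} - {x, y}" and "2 * star_binom n k 3 < trace_card F {w, x, y} {w, x} \<or>
    2 * star_binom n k 3 < trace_card F {w, x, y} {w, y}" by blast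
  then show ?thesis using that heavy_vertex[OF F nk xy w big] by blast
next
  case False
  define u where "u = star_binom n k 3"
  define V where "V = {1..n} - {x, y}"
  define P where "P G \<longleftrightarrow> G \<subseteq> nsets {1..n} k \<and> intersecting G \<and>
    5 * u < trace_card G {x, y} {x} \<and> 5 * u < trace_card G {x, y} {y} \<and>
    (\<forall>w\<in>V. trace_card G {w, x, y} {w, x} \<le> 2 * u \<and> trace_card G {w, x, y} {w, y} \<le> 2 * u)" for G
  have closed: "P (shift i j G)" if PG: "P G" and "(i, j) \<in> {(i, j). i \<in> V \<and> j \<in> V \<and> i < j}" for G i j
  proof -
    have ij: "i \<in> V" "j \<in> V" "i \<notin> {x, y}" "j \<notin> {x, y}" "i \<in> {1..n}" "j \<in> {1..n}"
      using that(2) by (auto simp: V_def)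
    note G = PG[unfolded P_def]
    have sh: "shift i j G \<subseteq> nsets {1..n} k" "intersecting (shift i j G)"
      using shift_nsets[of G "{1..n}" k i j] intersecting_shift[of G i j] G ij by simp_all
    have big': "5 * u < trace_card (shift i j G) {x, y} {x}" "5 * u < trace_card (shift i j G) {x, y} {y}"
      using G trace_card_shift[OF ij(3,4)] by auto
    have "trace_card (shift i j G) {w, x, y} {w, x} \<le> 2 * u \<and> trace_card (shift i j G) {w, x, y} {w, y} \<le> 2 * u"
      if w: "w \<in> V" for w
    proof -
      have wxy: "w \<notin> {x, y}" "w \<in> {1..n} - {x, y}" using w by (auto simp: V_def)
      have deg: "trace_card (shift i j G) {w, x, y} {w, t} \<le> 4 * u" if "t \<in> {x, y}" for t
      proof -
        have tr: "trace_card G {w, x, y} {w, t} \<le> 2 * u" "trace_card G {j, x, y} {j, t} \<le> 2 * u"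
          using G w ij that by auto
        show ?thesis
          using trace_card_shift_degree[OF finite_family[of G n k] ij(3,4) wxy(1), of "{t}"] G tr that
          by (auto split: if_splits)
      qed
      show ?thesis
      proof (rule ccontr)
        assume "\<not> ?thesis"
        then have "2 * star_binom n k 3 < trace_card (shift i j G) {w, x, y} {w, x} \<or>
          2 * star_binom n k 3 < trace_card (shift i j G) {w, x, y} {w, y}"
          unfolding u_def by linarith
        from heavy_vertex(3)[OF sh nk xy wxy(2) big'[unfolded u_def] this] show False
          using deg[of x] by (simp add: u_def)
      qed
    qed
    then show ?thesis using sh big' by (auto simp: P_def)
  qed
  have "P F" using False F big by (auto simp: P_def u_def V_def not_less)
  then have "\<exists>G. P G \<and> (\<forall>(i, j)\<in>{(i, j). i \<in> V \<and> j \<in> V \<and> i < j}. shift i j G = G)"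
  proof (rule ex_shift_stable)
    show "finite G \<and> (\<forall>B\<in>G. finite B)" if "P G" for G
    proof -
      have "G \<subseteq> nsets {1..n} k" using that by (simp add: P_def)
      then show ?thesis using finite_family finite_members by blast
    qed
  qed (use closed in blast)+
  then obtain G where "P G" and stable: "\<And>i j. i \<in> V \<Longrightarrow> j \<in> V \<Longrightarrow> i < j \<Longrightarrow> shift i j G = G" by blast
  note G = \<open>P G\<close>[unfolded P_def]
  have fG: "finite G" by (rule finite_family[of G n k]) (use G in simp)
  define v where "v = Min V"
  have cV: "card V = n - 2" using xy unfolding V_def by (subst card_Diff_subset) auto
  have "V \<noteq> {}" using cV nk by auto
  then have vV: "v \<in> V" unfolding v_def by (intro Min_in) (auto simp: V_def)
  have vmin: "v < z" if "z \<in> V - {v}" for z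
  proof -
    have "v \<le> z" unfolding v_def using that by (intro Min_le) (auto simp: V_def)
    then show ?thesis using that by auto
  qed
  \<comment> \<open>More than 5 u - 2 u members with trace \<open>{t}\<close> avoid the smallest
    point \<open>v\<close>, while the reflection bound for \<open>E = {v}\<close> is exactly
    u.\<close>
  have member: "\<exists>B\<in>G. B \<inter> {x, y} = {t} \<and> (\<forall>z. 2 * card (B \<inter> V \<inter> {..z}) \<le> card (V \<inter> {..z}))"
    if t: "t \<in> {x, y}" for t
    unfolding V_def
  proof (rule balanced_member[where E = "{v}"])
    have "trace_card G {x, y} {t} = trace_card G {v, x, y} {t} + trace_card G {v, x, y} {v, t}"
      by (rule trace_card_split[OF fG]) (use t vV in \<open>auto simp: V_def\<close>)
    moreover have "trace_card G {v, x, y} {v, t} \<le> 2 * u" using G t vV by auto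
    moreover have "5 * u < trace_card G {x, y} {t}" using G t by auto
    ultimately have "u < trace_card G {v, x, y} {t}" by linarith
    moreover have "{x, y} \<union> {v} = {v, x, y}" "card {v} = 1" "card {t} = 1" "card {x, y} = 2"
      using xy by auto
    moreover have "1 + 1 \<le> k - 1 \<longleftrightarrow> 3 \<le> k" "n - 2 - 1 = n - 3" "k - 1 - (1 + 1) = k - 3" by auto
    ultimately show "(if card {v} + 1 \<le> k - card {t} then n - card {x, y} - card {v} choose (k - card {t} - (card {v} + 1)) else 0)
      < trace_card G ({x, y} \<union> {v}) {t}"
      by (simp only: u_def star_binom_def)
  next
    show "e < z" if "e \<in> {v}" "z \<in> {1..n} - {x, y} - {v}" for e z
      using vmin[of z] that by (simp add: V_def)
  qed (use G t xy vV in \<open>auto simp: V_def\<close>)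
  obtain B where B: "B \<in> G" "B \<inter> {x, y} = {x}" "\<And>z. 2 * card (B \<inter> V \<inter> {..z}) \<le> card (V \<inter> {..z})"
    using member[of x] by blast
  obtain C where C: "C \<in> G" "C \<inter> {x, y} = {y}" "\<And>z. 2 * card (C \<inter> V \<inter> {..z}) \<le> card (V \<inter> {..z})"
    using member[of y] by blast
  have "(B - V) \<inter> (C - V) \<noteq> {}"
    by (rule stable_balanced_meet[OF _ stable _ B(1) C(1) B(3) C(3)]) (use G in \<open>auto simp: V_def\<close>)
  moreover have "B - V = {x}" "C - V = {y}" using B C G by (auto simp: V_def nsets_def)
  ultimately show ?thesis using xy by simp
qed

lemma two_smallest:
  fixes V :: "nat set"
  assumes "finite V" "2 \<le> card V"
  obtains a b where "a \<in> V" "b \<in> V" "a \<noteq> b" "\<And>e x. e \<in> {a, b} \<Longrightarrow> x \<in> V - {a, b} \<Longrightarrow> e < x"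
proof -
  define a where "a = Min V"
  define b where "b = Min (V - {a})"
  have "V \<noteq> {}" using assms by auto
  then have a: "a \<in> V" using assms by (simp add: a_def)
  have "card (V - {a}) \<noteq> 0" using a assms by simp
  then have "V - {a} \<noteq> {}" by force
  then have b: "b \<in> V - {a}" unfolding b_def using assms by (intro Min_in) auto
  have "a \<le> x" if "x \<in> V" for x using that assms by (simp add: a_def)
  moreover have "b \<le> x" if "x \<in> V - {a}" for x unfolding b_def using that assms by (intro Min_le) auto
  ultimately have "e < x" if "e \<in> {a, b}" "x \<in> V - {a, b}" for e x
    using that by (auto simp: order_less_le)
  then show ?thesis using that a b by blast
qed

lemma trace_card_mono:
  assumes "finite G" "w \<notin> Y" "T \<subseteq> Y"
  shows "trace_card G (insert w Y) T \<le> trace_card G Y T"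
    "trace_card G (insert w Y) (insert w T) \<le> trace_card G Y T"
  using trace_card_split[OF assms] by auto

text \<open>The vertex \<open>x\<close> is frozen: only the other points are compressed, which preserves all hypotheses
  unless some degree in the family of sets avoiding \<open>x\<close> exceeds \<open>5 u\<close>, and this is impossible.\<close>

lemma heavy_star_degree:
  assumes F: "F \<subseteq> nsets {1..n} k" "intersecting F" and nk: "36 * k \<le> n" "2 \<le> k"
    and x: "x \<in> {1..n}"
    and big: "8 * star_binom n k 3 < trace_card F {x} {x}" "12 * star_binom n k 3 < trace_card F {x} {}"
  shows "\<exists>y\<in>{1..n} - {x}. 10 * star_binom n k 3 < trace_card F {y, x} {y}"
proof (rule ccontr)
  assume neg: "\<not> ?thesis"
  define u where "u = star_binom n k 3"
  define V where "V = {1..n} - {x}"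
  define P where "P G \<longleftrightarrow> G \<subseteq> nsets {1..n} k \<and> intersecting G \<and>
    8 * u < trace_card G {x} {x} \<and> 12 * u < trace_card G {x} {} \<and>
    (\<forall>y\<in>V. trace_card G {y, x} {y} \<le> 10 * u)" for G
  \<comment> \<open>Degrees of at most 10 u are in fact at most 5 u, so a compression, which at most
    doubles them, keeps the invariant 10 u.\<close>
  have gap: "trace_card G {y, x} {y} \<le> 5 * u" if PG: "P G" and y: "y \<in> V" for G y
  proof (rule ccontr)
    note G = PG[unfolded P_def]
    have fG: "finite G" by (rule finite_family[of G n k]) (use G in simp)
    have yx: "y \<in> {1..n}" "y \<noteq> x" "{y, x} \<subseteq> {1..n}" using y x by (auto simp: V_def)
    assume "\<not> ?thesis"
    then have heavy: "5 * u < trace_card G {x, y} {y}" by (simp add: insert_commute)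
    have split: "trace_card G {x} {} = trace_card G {w, x} {} + trace_card G {w, x} {w}" if "w \<in> V" for w
      by (rule trace_card_split[OF fG]) (use that in \<open>auto simp: V_def\<close>)
    show False
    proof (cases "trace_card G {x, y} {x} \<le> 5 * u")
      case True
      have "trace_card G {x} {x} = trace_card G {y, x} {x} + trace_card G {y, x} {y, x}"
        by (rule trace_card_split[OF fG]) (use yx in auto)
      then have h: "3 * star_binom n k 3 < trace_card G {y, x} {y, x}"
        using True G by (simp add: insert_commute u_def)
      have "trace_card G {y, x} {} \<le> star_binom n k 3"
        by (rule trace_card_cross_unit[OF _ _ nk yx(3) _ _ _ _ _ _ _ h]) (use G yx in auto)
      then show False using split[OF y] G y by (auto simp: u_def)
    next
      case False
      then have big': "5 * star_binom n k 3 < trace_card G {x, y} {x}"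
        "5 * star_binom n k 3 < trace_card G {x, y} {y}"
        using heavy by (simp_all add: u_def)
      obtain w where w: "w \<in> {1..n} - {x, y}" "trace_card G {w, x, y} {y} \<le> star_binom n k 3"
        and h: "4 * star_binom n k 3 < trace_card G {w, x, y} {w, x}"
        using common_vertex[OF _ _ nk x yx(1) yx(2)[symmetric] big'] G by blast
      have h3: "3 * star_binom n k 3 < trace_card G {w, x, y} {w, x}" using h by linarith
      \<comment> \<open>At most 2 u members avoid both \<open>w\<close> and \<open>x\<close>, and at
        most 10 u contain \<open>w\<close> but not \<open>x\<close>. This contradicts the more than
        12 u members avoiding \<open>x\<close>.\<close>
      have "trace_card G {w, x, y} {} \<le> star_binom n k 3"
        by (rule trace_card_cross_unit[OF _ _ nk _ _ _ _ _ _ _ _ h3]) (use G yx x w in auto)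
      moreover have "trace_card G {w, x} {} = trace_card G {y, w, x} {} + trace_card G {y, w, x} {y}"
        by (rule trace_card_split[OF fG]) (use yx w in auto)
      moreover have "{y, w, x} = {w, x, y}" by auto
      ultimately have "trace_card G {w, x} {} \<le> 2 * u" using w(2) by (simp add: u_def)
      moreover have "w \<in> V" using w by (auto simp: V_def)
      ultimately show False using split[of w] G by (auto simp: u_def)
    qed
  qed
  have closed: "P (shift i j G)" if PG: "P G" and "(i, j) \<in> {(i, j). i \<in> V \<and> j \<in> V \<and> i < j}" for G i j
  proof -
    have ij: "i \<in> V" "j \<in> V" "i \<notin> {x}" "j \<notin> {x}" "i \<in> {1..n}" "j \<in> {1..n}"
      using that(2) by (auto simp: V_def)
    note G = PG[unfolded P_def]
    have sh: "shift i j G \<subseteq> nsets {1..n} k" "intersecting (shift i j G)"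
      using shift_nsets[of G "{1..n}" k i j] intersecting_shift[of G i j] G ij by simp_all
    have "trace_card (shift i j G) {y, x} {y} \<le> 10 * u" if y: "y \<in> V" for y
      using trace_card_shift_degree[OF finite_family[of G n k] ij(3,4), of y "{}"]
        gap[OF PG y] gap[OF PG ij(2)] G y by (auto simp: V_def split: if_splits)
    then show ?thesis using sh G trace_card_shift[OF ij(3,4)] by (auto simp: P_def)
  qed
  have "P F" using neg F big by (auto simp: P_def u_def V_def not_less)
  then have "\<exists>G. P G \<and> (\<forall>(i, j)\<in>{(i, j). i \<in> V \<and> j \<in> V \<and> i < j}. shift i j G = G)"
  proof (rule ex_shift_stable)
    show "finite G \<and> (\<forall>B\<in>G. finite B)" if "P G" for G
    proof -
      have "G \<subseteq> nsets {1..n} k" using that by (simp add: P_def)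
      then show ?thesis using finite_family finite_members by blast
    qed
  qed (use closed in blast)+
  then obtain G where PG: "P G" and stable: "\<And>i j. i \<in> V \<Longrightarrow> j \<in> V \<Longrightarrow> i < j \<Longrightarrow> shift i j G = G" by blast
  note G = PG[unfolded P_def]
  have fG: "finite G" by (rule finite_family[of G n k]) (use G in simp)
  have cV: "card V = n - 1" using x unfolding V_def by (subst card_Diff_subset) auto
  obtain a b where ab: "a \<in> V" "b \<in> V" "a \<noteq> b" "\<And>e z. e \<in> {a, b} \<Longrightarrow> z \<in> V - {a, b} \<Longrightarrow> e < z"
    by (rule two_smallest[of V]) (use cV nk in \<open>simp_all add: V_def\<close>)
  have abx: "a \<notin> {x}" "b \<notin> {x}" "b \<notin> {a, x}" using ab by (auto simp: V_def)
  \<comment> \<open>After removing the degrees of the two smallest points, more than 12 u - 5 u - 5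
    u members remain, against a reflection bound of u.\<close>
  have "\<exists>B\<in>G. B \<inter> {x} = {} \<and> (\<forall>z. 2 * card (B \<inter> ({1..n} - {x}) \<inter> {..z}) \<le> card (({1..n} - {x}) \<inter> {..z}))"
  proof (rule balanced_member[where E = "{a, b}"])
    have "trace_card G {x} {} = trace_card G {a, x} {} + trace_card G {a, x} {a}"
      by (rule trace_card_split[OF fG abx(1)]) simp
    moreover have "trace_card G {a, x} {} = trace_card G {b, a, x} {} + trace_card G {b, a, x} {b}"
      by (rule trace_card_split[OF fG abx(3)]) simp
    moreover have "trace_card G {a, b, x} {b} \<le> trace_card G {b, x} {b}"
      by (rule trace_card_mono[OF fG]) (use ab abx in auto)
    moreover have "{b, a, x} = {a, b, x}" "{x} \<union> {a, b} = {a, b, x}" by auto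
    ultimately have "u < trace_card G ({x} \<union> {a, b}) {}"
      using gap[OF PG ab(1)] gap[OF PG ab(2)] G by simp
    moreover have "card {a, b} = 2" "card {x} = 1" "card ({} :: nat set) = 0" using ab(3) by auto
    moreover have "2 + 1 \<le> k - 0 \<longleftrightarrow> 3 \<le> k" "n - 1 - 2 = n - 3" "k - 0 - (2 + 1) = k - 3" by auto
    ultimately show "(if card {a, b} + 1 \<le> k - card ({} :: nat set) then n - card {x} - card {a, b} choose (k - card ({} :: nat set) - (card {a, b} + 1)) else 0)
      < trace_card G ({x} \<union> {a, b}) {}"
      by (simp only: u_def star_binom_def)
  next
    show "e < z" if "e \<in> {a, b}" "z \<in> {1..n} - {x} - {a, b}" for e z
      using ab(4)[OF that(1), of z] that by (simp add: V_def)
  qed (use G x ab in \<open>auto simp: V_def\<close>)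
  then obtain B where B: "B \<in> G" "B \<inter> {x} = {}" "\<And>z. 2 * card (B \<inter> V \<inter> {..z}) \<le> card (V \<inter> {..z})"
    unfolding V_def by blast
  \<comment> \<open>Applied to \<open>B\<close> with itself: a balanced member avoiding
    \<open>x\<close> would have to meet itself outside \<open>V\<close>, where it is empty.\<close>
  have "(B - V) \<inter> (B - V) \<noteq> {}"
    by (rule stable_balanced_meet[OF _ stable _ B(1) B(1) B(3) B(3)]) (use G in \<open>auto simp: V_def\<close>)
  moreover have "B - V = {}" using B G by (auto simp: V_def nsets_def)
  ultimately show False by simp
qed

text \<open>Suppose all degrees are at most 8 u and compress. If the degree of \<open>i\<close> then
  exceeds 8 u, it is still at most 16 u, so more than 12 u members avoid \<open>i\<close>;
  \<open>heavy_star_degree\<close> yields another vertex of degree above 10 u, which is impossible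
  since only \<open>i\<close> gained. So the bound survives to a fully compressed family, where a
  balanced member gives a contradiction.\<close>

lemma large_degree:
  assumes F: "F \<subseteq> nsets {1..n} k" "intersecting F" and nk: "36 * k \<le> n" "2 \<le> k"
    and big: "28 * star_binom n k 3 < card F"
  shows "\<exists>x\<in>{1..n}. 8 * star_binom n k 3 < trace_card F {x} {x}"
proof (rule ccontr)
  assume neg: "\<not> ?thesis"
  define u where "u = star_binom n k 3"
  define V where "V = {1..n}"
  define P where "P G \<longleftrightarrow> G \<subseteq> nsets {1..n} k \<and> intersecting G \<and> 28 * u < card G \<and>
    (\<forall>x\<in>V. trace_card G {x} {x} \<le> 8 * u)" for G
  have total: "card G = trace_card G {} {}" for G by (simp add: trace_card_def)
  have closed: "P (shift i j G)" if PG: "P G" and "(i, j) \<in> {(i, j). i \<in> V \<and> j \<in> V \<and> i < j}" for G i j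
  proof -
    have ij: "i \<in> V" "j \<in> V" "i \<in> {1..n}" "j \<in> {1..n}" using that(2) by (auto simp: V_def)
    note G = PG[unfolded P_def]
    have sh: "shift i j G \<subseteq> nsets {1..n} k" "intersecting (shift i j G)" "card (shift i j G) = card G"
      using shift_nsets[of G "{1..n}" k i j] intersecting_shift[of G i j] card_shift[of i j G] G ij by simp_all
    have fs: "finite (shift i j G)" by (rule finite_family[OF sh(1)])
    have deg: "trace_card (shift i j G) {x} {x} \<le> trace_card G {x} {x} + (if x = i then trace_card G {j} {j} else 0)" for x
      using trace_card_shift_degree[OF finite_family[of G n k], of i "{}" j x "{}"] G by simp
    have degG: "trace_card G {x} {x} \<le> 8 * u" if "x \<in> V" for x using G that by blast
    have other: "trace_card (shift i j G) {x} {x} \<le> 8 * u" if "x \<in> V" "x \<noteq> i" for x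
      using deg[of x] degG[OF that(1)] that(2) by simp
    have "trace_card (shift i j G) {i} {i} \<le> 8 * u"
    proof (rule ccontr)
      assume "\<not> ?thesis"
      then have h: "8 * star_binom n k 3 < trace_card (shift i j G) {i} {i}" by (simp add: u_def)
      have "trace_card (shift i j G) {i} {i} \<le> 16 * u" using deg[of i] degG[OF ij(1)] degG[OF ij(2)] by simp
      moreover have "card (shift i j G) = trace_card (shift i j G) {i} {} + trace_card (shift i j G) {i} {i}"
        unfolding total by (rule trace_card_split[OF fs]) auto
      ultimately have "12 * star_binom n k 3 < trace_card (shift i j G) {i} {}"
        using G sh(3) by (simp add: u_def)
      then obtain y where y: "y \<in> {1..n} - {i}" "10 * star_binom n k 3 < trace_card (shift i j G) {y, i} {y}"
        using heavy_star_degree[OF sh(1,2) nk ij(3) h] by blast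
      have "trace_card (shift i j G) {i, y} {y} \<le> trace_card (shift i j G) {y} {y}"
        by (rule trace_card_mono[OF fs]) (use y in auto)
      then show False using y other[of y] by (simp add: V_def u_def insert_commute)
    qed
    then have "\<forall>x\<in>V. trace_card (shift i j G) {x} {x} \<le> 8 * u" using other by metis
    then show ?thesis using sh G by (simp add: P_def)
  qed
  have "P F" using neg F big by (auto simp: P_def u_def V_def not_less)
  then have "\<exists>G. P G \<and> (\<forall>(i, j)\<in>{(i, j). i \<in> V \<and> j \<in> V \<and> i < j}. shift i j G = G)"
  proof (rule ex_shift_stable)
    show "finite G \<and> (\<forall>B\<in>G. finite B)" if "P G" for G
    proof -
      have "G \<subseteq> nsets {1..n} k" using that by (simp add: P_def)
      then show ?thesis using finite_family finite_members by blast
    qed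
  qed (use closed in blast)+
  then obtain G where PG: "P G" and stable: "\<And>i j. i \<in> V \<Longrightarrow> j \<in> V \<Longrightarrow> i < j \<Longrightarrow> shift i j G = G" by blast
  note G = PG[unfolded P_def]
  have fG: "finite G" by (rule finite_family[of G n k]) (use G in simp)
  obtain a b where ab: "a \<in> V" "b \<in> V" "a \<noteq> b" "\<And>e z. e \<in> {a, b} \<Longrightarrow> z \<in> V - {a, b} \<Longrightarrow> e < z"
    by (rule two_smallest[of V]) (use nk in \<open>simp_all add: V_def\<close>)
  have "\<exists>B\<in>G. B \<inter> {} = {} \<and> (\<forall>z. 2 * card (B \<inter> ({1..n} - {}) \<inter> {..z}) \<le> card (({1..n} - {}) \<inter> {..z}))"
  proof (rule balanced_member[where E = "{a, b}"])
    have "card G = trace_card G {a} {} + trace_card G {a} {a}"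
      unfolding total by (rule trace_card_split[OF fG]) auto
    moreover have "trace_card G {a} {} = trace_card G {b, a} {} + trace_card G {b, a} {b}"
      by (rule trace_card_split[OF fG]) (use ab in auto)
    moreover have "trace_card G {a, b} {b} \<le> trace_card G {b} {b}"
      by (rule trace_card_mono[OF fG]) (use ab in auto)
    moreover have "{b, a} = {a, b}" "trace_card G {a} {a} \<le> 8 * u" "trace_card G {b} {b} \<le> 8 * u"
      using G ab by auto
    ultimately have *: "12 * u < trace_card G {a, b} {}" using G by simp
    \<comment> \<open>No vertex is frozen here, so the reflection bound lives on one more point; by
      Pascal's rule it is at most 2 u.\<close>
    have "n - 2 choose (k - 3) \<le> 2 * u" if "3 \<le> k"
    proof (cases "k = 3")
      case False
      then have "k - 3 = Suc (k - 4)" "n - 2 = Suc (n - 3)" using that nk by auto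
      moreover have "n - 3 choose (k - 4) \<le> n - 3 choose (k - 3)"
        by (rule binomial_mono) (use that nk in auto)
      ultimately show ?thesis using that by (simp add: u_def star_binom_def)
    qed (simp add: u_def star_binom_def)
    then have "(if 3 \<le> k then n - 2 choose (k - 3) else 0) < trace_card G {a, b} {}"
      using * by auto
    moreover have "card {a, b} = 2" "card ({} :: nat set) = 0" "{} \<union> {a, b} = {a, b}" using ab(3) by auto
    moreover have "2 + 1 \<le> k - 0 \<longleftrightarrow> 3 \<le> k" "n - 0 - 2 = n - 2" "k - 0 - (2 + 1) = k - 3" by auto
    ultimately show "(if card {a, b} + 1 \<le> k - card ({} :: nat set) then n - card ({} :: nat set) - card {a, b} choose (k - card ({} :: nat set) - (card {a, b} + 1)) else 0)
      < trace_card G ({} \<union> {a, b}) {}"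
      by (simp only:)
  next
    show "e < z" if "e \<in> {a, b}" "z \<in> {1..n} - {} - {a, b}" for e z
      using ab(4)[OF that(1), of z] that by (simp add: V_def)
  qed (use G ab in \<open>auto simp: V_def\<close>)
  then obtain B where B: "B \<in> G" "\<And>z. 2 * card (B \<inter> V \<inter> {..z}) \<le> card (V \<inter> {..z})"
    unfolding V_def by auto
  have "(B - V) \<inter> (B - V) \<noteq> {}"
    by (rule stable_balanced_meet[OF _ stable _ B(1) B(1) B(2) B(2)]) (use G in \<open>auto simp: V_def\<close>)
  moreover have "B - V = {}" using B G by (auto simp: V_def nsets_def)
  ultimately show False by simp
qed

section \<open>The heavy triple\<close>

text \<open>A maximum-degree vertex \<open>x\<close> and a vertex \<open>y\<close> of large degree
  among the members avoiding \<open>x\<close> give two large families with traces \<open>{x}\<close>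
  and \<open>{y}\<close>, hence a common \<open>w\<close>. The pair \<open>{x, y}\<close> is heavy
  as well: of the more than 28 u members avoiding \<open>w\<close>, at most 3 u have another
  trace.\<close>

lemma heavy_triple:
  assumes F: "F \<subseteq> nsets {1..n} k" "intersecting F" and nk: "36 * k \<le> n" "2 \<le> k"
    and div: "\<And>v. v \<in> {1..n} \<Longrightarrow> 28 * star_binom n k 3 < trace_card F {v} {}"
  obtains a b c where "{a, b, c} \<subseteq> {1..n}" "a \<noteq> b" "a \<noteq> c" "b \<noteq> c"
    "3 * star_binom n k 3 < trace_card F {a, b, c} {a, b}"
    "3 * star_binom n k 3 < trace_card F {a, b, c} {a, c}"
    "3 * star_binom n k 3 < trace_card F {a, b, c} {b, c}"
proof -
  define u where "u = star_binom n k 3"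
  have fF: "finite F" by (rule finite_family[OF F(1)])
  have ne: "{1..n} \<noteq> {}" using nk by auto
  obtain x where x: "x \<in> {1..n}" and xmax: "\<And>y. y \<in> {1..n} \<Longrightarrow> trace_card F {y} {y} \<le> trace_card F {x} {x}"
  proof -
    have "Max ((\<lambda>y. trace_card F {y} {y}) ` {1..n}) \<in> (\<lambda>y. trace_card F {y} {y}) ` {1..n}"
      using ne by (intro Max_in) auto
    then obtain x where "x \<in> {1..n}" "trace_card F {x} {x} = Max ((\<lambda>y. trace_card F {y} {y}) ` {1..n})"
      by auto
    then show ?thesis using that[of x] by simp
  qed
  define G where "G = {B \<in> F. B \<inter> {x} = {}}"
  have G: "G \<subseteq> nsets {1..n} k" "intersecting G" "28 * u < card G"
    using F div[OF x] by (auto simp: G_def intersecting_def trace_card_def u_def)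
  obtain y where y: "y \<in> {1..n}" "8 * u < trace_card G {y} {y}"
    using large_degree[OF G(1,2) nk] G(3) by (auto simp: u_def)
  have xy: "x \<noteq> y"
  proof
    assume "x = y"
    have "trace_card G {y} {y} = card ({} :: nat set set)"
      unfolding trace_card_def by (rule arg_cong[of _ _ card]) (auto simp: G_def \<open>x = y\<close>)
    then show False using y(2) by simp
  qed
  have "{B \<in> G. B \<inter> {y} = {y}} = {B \<in> F. B \<inter> {x, y} = {y}}"
    using xy by (auto simp: G_def)
  then have ty: "8 * u < trace_card F {x, y} {y}" using y(2) by (simp add: trace_card_def)
  have "trace_card F {x} {x} = trace_card F {y, x} {x} + trace_card F {y, x} {y, x}"
    "trace_card F {y} {y} = trace_card F {x, y} {y} + trace_card F {x, y} {x, y}"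
    by (rule trace_card_split[OF fF]; use xy in simp)+
  \<comment> \<open>Maximality of the degree of \<open>x\<close> transfers the bound, since members
    containing both points cancel.\<close>
  then have tx: "8 * u < trace_card F {x, y} {x}"
    using xmax[OF y(1)] ty by (simp add: insert_commute)
  obtain w where w: "w \<in> {1..n} - {x, y}" "trace_card F {w, x, y} {x} \<le> u" "trace_card F {w, x, y} {y} \<le> u"
    "4 * u < trace_card F {w, x, y} {w, x}" "4 * u < trace_card F {w, x, y} {w, y}"
    unfolding u_def
    by (rule common_vertex[OF F nk x y(1) xy]) (use tx ty in \<open>simp_all add: u_def\<close>)
  have h: "3 * star_binom n k 3 < trace_card F {w, x, y} {w, x}" using w(4) by (simp add: u_def)
  have "trace_card F {w, x, y} {} \<le> u"
    unfolding u_def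
    by (rule trace_card_cross_unit[OF F nk _ _ _ _ _ _ _ _ h]) (use x y(1) w(1) xy in auto)
  moreover have "trace_card F {w} {} = trace_card F {y, w} {} + trace_card F {y, w} {y}"
    by (rule trace_card_split[OF fF]) (use w(1) in auto)
  moreover have "trace_card F {y, w} {} = trace_card F {x, y, w} {} + trace_card F {x, y, w} {x}"
    by (rule trace_card_split[OF fF]) (use w(1) xy in auto)
  moreover have "trace_card F {y, w} {y} = trace_card F {x, y, w} {y} + trace_card F {x, y, w} {x, y}"
    by (rule trace_card_split[OF fF]) (use w(1) xy in auto)
  moreover have "{x, y, w} = {w, x, y}" by auto
  moreover have "28 * u < trace_card F {w} {}" using div[of w] w(1) by (simp add: u_def)
  ultimately have "3 * u < trace_card F {w, x, y} {x, y}" using w(2,3) by simp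
  then show ?thesis
    using that[of w x y] w x y(1) xy h by (auto simp: u_def)
qed

text \<open>The two terms on the left bound the sets that miss a heavy triple and those that meet it in exactly
  one point.\<close>

lemma star_binom_vandermonde:
  assumes "m \<le> N" "1 \<le> k"
  shows "star_binom N k m + 3 * star_binom N (k - 1) m \<le> star_binom (N + 3) k m"
proof (cases "m < k")
  case True
  define M i where "M = N - m" and "i = k - m - 1"
  have e: "k - m = Suc i" "k - 1 - m = i" "N + 3 - m = Suc (Suc (Suc M))"
    using True assms by (auto simp: M_def i_def)
  have "M choose i \<le> Suc M choose i" "M choose i \<le> Suc (Suc M) choose i"
    by (rule binomial_right_mono; simp)+
  then have "(M choose Suc i) + 3 * (M choose i) \<le> Suc (Suc (Suc M)) choose Suc i" by simp
  moreover have "m \<le> k" "m \<le> k - 1" using True by auto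
  ultimately show ?thesis by (simp only: star_binom_def e if_True M_def[symmetric])
next
  case False
  then show ?thesis using assms by (cases "m = k") (auto simp: star_binom_def)
qed

section \<open>Binomial estimates and diversity\<close>

lemma star_binom_absorb: "M * star_binom M a 1 = a * (M choose a)"
  using binomial_absorption[of "a - 1" M] by (cases a) (auto simp: star_binom_def)

text \<open>Each of \<open>h\<close> Pascal steps loses at most the fraction a/M of
  \<open>M choose a\<close>, so together they lose at most half.\<close>

lemma binomial_half:
  assumes "2 * h * a \<le> M" "h \<le> M" "0 < M"
  shows "M choose a \<le> 2 * (M - h choose a)"
proof -
  have "2 * (M * (M choose a)) \<le> 2 * (M * ((M - h choose a) + h * star_binom M a 1))"
    using binomial_drop[OF assms(2), of a] by simp
  also have "\<dots> = 2 * (M * (M - h choose a)) + 2 * h * (M * star_binom M a 1)"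
    by (simp add: algebra_simps)
  also have "\<dots> = 2 * (M * (M - h choose a)) + 2 * h * a * (M choose a)"
    by (simp only: star_binom_absorb mult.assoc)
  also have "\<dots> \<le> 2 * (M * (M - h choose a)) + M * (M choose a)"
    using mult_le_mono1[OF assms(1), of "M choose a"] by simp
  finally have "M * (M choose a) \<le> M * (2 * (M - h choose a))" by simp
  then show ?thesis using assms(3) by simp
qed

text \<open>The full drop of \<open>d - 3\<close> is done in two halvings of about half the length,
  because \<open>d * k \<le> n\<close> is too weak for \<open>binomial_half\<close> in one stroke.
  Rounding is covered by \<open>2 * h \<ge> d - 3\<close>.\<close>

lemma binomial_quarter:
  assumes "d * k \<le> n" "36 \<le> d" "2 \<le> k"
  shows "n - 3 choose (k - 2) \<le> 4 * (n - 3 - (d - 3) choose (k - 2))"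
proof -
  define h where "h = (d - 2) div 2"
  define e j where "e = d - 2" and "j = k - 2"
  then have ej: "d = e + 2" "k = j + 2" using assms(2,3) by auto
  have "e * j + 2 * e + 2 * j + 4 \<le> n" using assms(1) by (simp add: ej algebra_simps)
  moreover have "2 * h * j \<le> e * j" by (rule mult_le_mono1) (simp add: h_def ej)
  moreover have "2 * h \<le> e" by (simp add: h_def ej)
  ultimately have a: "2 * h * j \<le> n - 3 - h" "h \<le> n - 3 - h" "0 < n - 3 - h" by linarith+
  have "n - 3 choose j \<le> 2 * (n - 3 - h choose j)"
    by (rule binomial_half) (use a in linarith)+
  moreover have "n - 3 - h choose j \<le> 2 * (n - 3 - h - h choose j)"
    by (rule binomial_half) (use a in linarith)+
  moreover have "n - 3 - h - h choose j \<le> n - 3 - (d - 3) choose j"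
    by (rule binomial_right_mono) (use \<open>2 * h \<le> e\<close> assms(2) in \<open>simp add: h_def ej; linarith\<close>)
  ultimately show ?thesis by (simp add: ej)
qed

lemma card_link: "card (link F x) = trace_card F {x} {x}"
proof -
  have "link F x = (\<lambda>A. A - {x}) ` {A \<in> F. A \<inter> {x} = {x}}" by (auto simp: link_def)
  moreover have "inj_on (\<lambda>A. A - {x}) {A \<in> F. A \<inter> {x} = {x}}"
    by (rule inj_onI) blast
  ultimately show ?thesis by (simp add: trace_card_def card_image)
qed

lemma diversity_le:
  assumes "finite F" "x \<in> {1..n}"
  shows "diversity n F \<le> int (trace_card F {x} {})"
proof -
  have "card (link F x) \<le> max_degree n F"
    unfolding max_degree_def by (rule Max_ge) (use assms in auto)
  moreover have "card F = trace_card F {x} {} + trace_card F {x} {x}"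
    using trace_card_split[OF assms(1), of x "{}" "{}"] by (simp add: trace_card_def)
  ultimately show ?thesis by (simp add: diversity_def card_link)
qed

lemma excess_bound:
  fixes r X P E \<alpha> d :: real
  assumes "r * P \<le> E * (\<alpha> * X + r)" "0 \<le> r" "0 \<le> E" "0 < X" "X \<le> 4 * P" "35 * E \<le> X" "36 \<le> d" "0 \<le> \<alpha>"
  shows "r \<le> d * \<alpha> / 2 * E"
proof -
  \<comment> \<open>1/4 - 1/35 exceeds 1/18; the constant 18 matches d/2 for the smallest admissible
    \<open>d\<close>.\<close>
  have "X / 18 \<le> P - E" using assms(4-6) by simp
  then have "r * (X / 18) \<le> r * (P - E)" using assms(2) by (intro mult_left_mono)
  also have "\<dots> \<le> E * \<alpha> * X" using assms(1) by (simp add: algebra_simps)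
  finally have "X * r \<le> X * (18 * \<alpha> * E)" by (simp add: algebra_simps)
  then have "r \<le> 18 * (\<alpha> * E)" using assms(4) by simp
  also have "\<dots> \<le> d / 2 * (\<alpha> * E)" using assms by (intro mult_right_mono) auto
  finally show ?thesis by simp
qed

text \<open>The three quantities are linked by the absorption identities \<open>UV\<close> and
  \<open>XV\<close>, so each bound reduces to comparing linear factors in \<open>n\<close> and
  \<open>k\<close>. For \<open>k = 2\<close> both star counts vanish.\<close>

lemma diversity_unit_bounds:
  fixes \<alpha> d :: real
  assumes "36 \<le> d" "\<alpha> < 1" "d * real k \<le> (1 - \<alpha>) * real n" "2 \<le> k" "36 * k \<le> n"
  shows "d * star_binom (n - 3) (k - 2) 1 \<le> (1 - \<alpha>) * (n - 3 choose (k - 2))"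
    "35 * star_binom n k 3 \<le> 36 * star_binom (n - 3) (k - 2) 1"
    "35 * star_binom n k 3 \<le> n - 3 choose (k - 2)"
proof -
  define X U V where "X = n - 3 choose (k - 2)" and "U = star_binom n k 3"
    and "V = star_binom (n - 3) (k - 2) 1"
  have XV: "(n - 3) * V = (k - 2) * X" unfolding V_def X_def by (rule star_binom_absorb)
  have UV: "(n - k) * U = (n - 3) * V"
  proof (cases "k = 2")
    case False
    then have "n - 3 - (k - 3) = n - k" "k - 2 - 1 = k - 3" "1 \<le> k - 2" "3 \<le> k" using assms(4) by auto
    then show ?thesis
      using binomial_absorb_comp[of "n - 3" "k - 3"] by (simp add: U_def V_def star_binom_def)
  qed (simp add: U_def V_def star_binom_def)
  have n: "3 < n" "k < n" using assms(4,5) by auto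
  have "35 * ((n - k) * U) \<le> (n - k) * (36 * V)"
  proof -
    have "35 * (n - 3) \<le> 36 * (n - k)" using assms(4,5) by linarith
    from mult_le_mono1[OF this, of V] show ?thesis by (simp add: UV mult.assoc mult.left_commute)
  qed
  then have "(n - k) * (35 * U) \<le> (n - k) * (36 * V)" by (simp only: mult.left_commute)
  then show "35 * star_binom n k 3 \<le> 36 * star_binom (n - 3) (k - 2) 1"
    using n by (simp add: U_def V_def)
  have "35 * ((n - k) * U) \<le> (n - k) * X"
  proof -
    have "35 * (k - 2) \<le> n - k" using assms(4,5) by linarith
    from mult_le_mono1[OF this, of X] show ?thesis by (simp add: UV XV mult.assoc)
  qed
  then have "(n - k) * (35 * U) \<le> (n - k) * X" by (simp only: mult.left_commute)
  then show "35 * star_binom n k 3 \<le> n - 3 choose (k - 2)" using n by (simp add: U_def X_def)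
  have "real n * real (k - 2) * (d * V) \<le> real k * real (n - 3) * (d * V)"
  proof (rule mult_right_mono)
    have "n * (k - 2) \<le> k * (n - 3)"
      using assms(4,5) by (simp add: diff_mult_distrib2 algebra_simps)
    then show "real n * real (k - 2) \<le> real k * real (n - 3)" by (metis of_nat_le_iff of_nat_mult)
  qed (use assms(1) in simp)
  also have "\<dots> = d * real k * real ((n - 3) * V)" by simp
  also have "\<dots> \<le> (1 - \<alpha>) * real n * real ((n - 3) * V)"
    by (rule mult_right_mono[OF assms(3)]) simp
  also have "\<dots> = real n * real (k - 2) * ((1 - \<alpha>) * X)" unfolding XV by simp
  finally have *: "real n * real (k - 2) * (d * V) \<le> real n * real (k - 2) * ((1 - \<alpha>) * X)" .
  show "d * star_binom (n - 3) (k - 2) 1 \<le> (1 - \<alpha>) * (n - 3 choose (k - 2))"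
  proof (cases "k = 2")
    case True
    then show ?thesis using assms(2) by (simp add: star_binom_def)
  next
    case False
    then have "0 < real n * real (k - 2)" using assms(4) n by simp
    then show ?thesis using * unfolding X_def V_def by (metis mult_le_cancel_left_pos)
  qed
qed

section \<open>Counting members around the heavy triple\<close>

lemma triple_subset_less:
  assumes "S \<subseteq> {a, b, c}" "card S < 2"
  shows "S \<in> {{}, {a}, {b}, {c}}"
proof -
  have "finite S" using finite_subset[OF assms(1)] by simp
  consider "card S = 0" | "card S = 1" using assms(2) by linarith
  then show ?thesis
  proof cases
    case 1
    then show ?thesis using \<open>finite S\<close> by simp
  next
    case 2
    then obtain x where "S = {x}" by (auto simp: card_1_singleton_iff)
    then show ?thesis using assms(1) by auto
  qed
qed

lemma triple_subset_two:
  assumes "a \<noteq> b" "a \<noteq> c" "b \<noteq> c" "S \<subseteq> {a, b, c}" "card S = 2"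
  shows "S \<in> {{b, c}, {a, c}, {a, b}}"
proof -
  have "card ({a, b, c} - S) = 1"
    using card_Diff_subset[OF finite_subset[OF assms(4)] assms(4)] assms by simp
  then obtain x where x: "{a, b, c} - S = {x}" by (auto simp: card_1_singleton_iff)
  then have "S = {a, b, c} - {x}" "x \<in> {a, b, c}" using assms(4) by blast+
  then show ?thesis using assms(1-3) by auto
qed

theorem theorem1p10:
  fixes n k :: nat and d :: int and \<alpha> :: real and F :: "nat set set"
  assumes "k \<ge> 2"
    and "F \<subseteq> nsets {1..n} k"
    and "intersecting F"
    and "real_of_int (diversity n F) = (1 - \<alpha>) * ibinom (int n - 3) (int k - 2)"
    and "d \<ge> 36"
    and "0 \<le> \<alpha>" and "\<alpha> < 1"
    and "real n \<ge> real_of_int d * real k / (1 - \<alpha>)"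
  shows "\<exists>u v w. {u, v, w} \<in> nsets {1..n} 3 \<and>
    real (card (F - two_family_star n k u v w))
      \<le> real_of_int d * \<alpha> / 2 * ibinom (int n - d + 3) (int k - d + 3) \<and>
    real (card (two_family n k u v w - F))
      \<le> 3 * \<alpha> * ibinom (int n - 3) (int k - 2)
         + 3 * real_of_int d * \<alpha> / 2 * ibinom (int n - d + 3) (int k - d + 3)"
proof -
  define D m where "D = nat d" and "m = nat d - 3"
  have dD: "d = int D" "36 \<le> D" unfolding D_def using assms(5) by linarith+
  have dk: "real_of_int d * real k \<le> (1 - \<alpha>) * real n"
    using assms(7,8) by (simp add: field_simps)
  also have "\<dots> \<le> 1 * real n" using assms(6) by (intro mult_right_mono) auto
  finally have "real (D * k) \<le> real n" by (simp add: dD)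
  then have Dk: "D * k \<le> n" by (simp only: of_nat_le_iff)
  have nk: "36 * k \<le> n" using Dk mult_le_mono1[OF dD(2), of k] by linarith
  have Dn: "D \<le> n" using Dk assms(1) by (metis le_trans mult_le_mono2 nat_mult_1_right one_le_numeral)
  have mD: "m = D - 3" "33 \<le> m" "m \<le> n - 3" using dD(2) Dn by (auto simp: m_def D_def)
  \<comment> \<open>With \<open>m = d - 3\<close>, \<open>E\<close> is the last binomial coefficient
    of the claim, and both are 0 when \<open>k < m\<close>.\<close>
  define X P E U where "X = n - 3 choose (k - 2)" and "P = n - 3 - m choose (k - 2)"
    and "E = star_binom n k m" and "U = star_binom n k 3"
  define u' where "u' = star_binom (n - 3) (k - 2) 1"
  have ibX: "ibinom (int n - 3) (int k - 2) = real X"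
  proof -
    have "int n - 3 = int (n - 3)" "int k - 2 = int (k - 2)" using nk assms(1) by auto
    then show ?thesis by (simp only: ibinom_of_nat X_def)
  qed
  have ibE: "ibinom (int n - d + 3) (int k - d + 3) = real E"
  proof (cases "m \<le> k")
    case True
    then have "int n - d + 3 = int (n - m)" "int k - d + 3 = int (k - m)" using mD dD by auto
    then show ?thesis using True by (simp only: ibinom_of_nat E_def star_binom_def if_True)
  next
    case False
    then show ?thesis using mD dD by (simp add: ibinom_def E_def star_binom_def)
  qed
  have d36: "36 \<le> real_of_int d" using assms(5) by linarith
  note unit = diversity_unit_bounds[OF d36 assms(7) dk assms(1) nk, folded X_def U_def u'_def]
  have Xpos: "0 < X" using nk assms(1) by (simp add: X_def)
  have gamma_u': "36 * real u' \<le> (1 - \<alpha>) * X"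
    using unit(1) mult_right_mono[OF d36, of "real u'"] by linarith
  have gamma_U: "28 * real U < (1 - \<alpha>) * X"
  proof (cases "U = 0")
    case True
    then show ?thesis using Xpos assms(7) by simp
  next
    case False
    have "35 * real U \<le> 36 * real u'" using unit(2) by linarith
    then show ?thesis using gamma_u' False by linarith
  qed
  have fF: "finite F" by (rule finite_family[OF assms(2)])
  have gamma: "(1 - \<alpha>) * X \<le> trace_card F {x} {}" if "x \<in> {1..n}" for x
    using diversity_le[OF fF that] assms(4) unfolding ibX by linarith
  have "28 * star_binom n k 3 < trace_card F {x} {}" if "x \<in> {1..n}" for x
    using gamma[OF that] gamma_U unfolding U_def by linarith
  then obtain a b c where abc: "{a, b, c} \<subseteq> {1..n}" "a \<noteq> b" "a \<noteq> c" "b \<noteq> c"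
    and heavy: "3 * U < trace_card F {a, b, c} {a, b}" "3 * U < trace_card F {a, b, c} {a, c}"
      "3 * U < trace_card F {a, b, c} {b, c}"
    unfolding U_def by (rule heavy_triple[OF assms(2,3) nk assms(1)])
  define Y where "Y = {a, b, c}"
  have Y: "Y \<subseteq> {1..n}" "card Y = 3" using abc by (auto simp: Y_def)
  define t where "t = trace_card F Y"
  define r where "r = t {} + t {a} + t {b} + t {c}"
  \<comment> \<open>The members avoiding \<open>x\<close> number at least the diversity, and all of
    them except those with trace \<open>{y, z}\<close> are counted by \<open>r\<close>.\<close>
  have pair: "(1 - \<alpha>) * X \<le> t {y, z} + r" if xyz: "{x, y, z} = Y" "x \<noteq> y" "x \<noteq> z" "y \<noteq> z" for x y z
  proof -
    have "trace_card F {x} {} = trace_card F {y, x} {} + trace_card F {y, x} {y}"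
      by (rule trace_card_split[OF fF]) (use xyz in auto)
    moreover have "trace_card F {y, x} {} = trace_card F {z, y, x} {} + trace_card F {z, y, x} {z}"
      by (rule trace_card_split[OF fF]) (use xyz in auto)
    moreover have "trace_card F {y, x} {y} = trace_card F {z, y, x} {y} + trace_card F {z, y, x} {z, y}"
      by (rule trace_card_split[OF fF]) (use xyz in auto)
    moreover have "{z, y, x} = Y" "{z, y} = {y, z}" using xyz by auto
    ultimately have "trace_card F {x} {} = t {} + t {z} + t {y} + t {y, z}" by (simp add: t_def)
    moreover have "t {y} + t {z} \<le> t {a} + t {b} + t {c}"
    proof -
      have "t {y} + t {z} = (\<Sum>v\<in>{y, z}. t {v})" using xyz by simp
      also have "\<dots> \<le> (\<Sum>v\<in>Y. t {v})" by (rule sum_mono2) (use xyz Y_def in auto)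
      also have "\<dots> = t {a} + t {b} + t {c}" using abc by (simp add: Y_def)
      finally show ?thesis .
    qed
    moreover have "x \<in> {1..n}" using xyz(1) Y(1) by blast
    ultimately show ?thesis using gamma[of x] by (simp add: r_def)
  qed
  have pairs: "(1 - \<alpha>) * X \<le> t {b, c} + r" "(1 - \<alpha>) * X \<le> t {a, c} + r" "(1 - \<alpha>) * X \<le> t {a, b} + r"
    using pair[of a b c] pair[of b a c] pair[of c a b] abc by (auto simp: Y_def)
  have "t S \<le> star_binom (n - 3) (k - card S) 3"
    if "3 * U < t T" "T \<subseteq> Y" "S \<subseteq> Y" "T \<inter> S = {}" "card T = 2" for S T
    using trace_card_cross_le[OF assms(2,3) nk assms(1) Y(1) that(2-5), of 3] that(1) Y(2)
    by (simp add: t_def U_def)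
  \<comment> \<open>Each of the four light traces is disjoint from some heavy pair.\<close>
  from this[of "{b, c}" "{}"] this[of "{b, c}" "{a}"] this[of "{a, c}" "{b}"] this[of "{a, b}" "{c}"]
  have "r \<le> star_binom (n - 3) k 3 + 3 * star_binom (n - 3) (k - 1) 3"
    using heavy abc by (auto simp: r_def t_def Y_def)
  also have "\<dots> \<le> U"
    using star_binom_vandermonde[of 3 "n - 3" k] nk assms(1) by (simp add: U_def)
  finally have rU: "r \<le> U" .
  \<comment> \<open>The drop from \<open>X\<close> to \<open>P\<close> costs at most
    \<open>m * u'\<close>, and the diversity is at least \<open>d * u'\<close>; the spare
    \<open>3 * u'\<close> absorbs \<open>r \<le> U\<close>. If \<open>u' = 0\<close>, then
    \<open>r = 0\<close> and positivity of the diversity gives strictness.\<close>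
  have small: "X < t T + P" if "(1 - \<alpha>) * X \<le> t T + r" for T
  proof -
    have drop: "X \<le> P + m * u'"
      unfolding X_def P_def u'_def by (rule binomial_drop) (use mD in simp)
    have "real m * real u' + 3 * real u' = real_of_int d * real u'"
      using mD dD by (simp add: algebra_simps of_nat_diff)
    then have "real m * real u' + 3 * real u' \<le> (1 - \<alpha>) * X" using unit(1) by linarith
    moreover have "real r < 3 * real u' \<or> real r + 3 * real u' < (1 - \<alpha>) * X \<and> u' = 0"
    proof (cases "u' = 0")
      case True
      then show ?thesis using rU unit(2) gamma_U by simp
    next
      case False
      then show ?thesis using rU unit(2) by linarith
    qed
    ultimately have "real m * real u' + real r < (1 - \<alpha>) * X" by auto
    moreover have "real X \<le> real P + real m * real u'"
      using drop by (metis of_nat_add of_nat_le_iff of_nat_mult)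
    ultimately have "real X < real (t T) + real P" using that by (simp add: algebra_simps)
    then show ?thesis by linarith
  qed
  \<comment> \<open>Now the exact cross-intersecting bound is fed with the deficiency of the pair
    \<open>T\<close>, which is at most \<alpha> X + r.\<close>
  have exact: "real (t S) * P \<le> star_binom (n - 3) (k - card S) m * (\<alpha> * X + r)"
    if T: "(1 - \<alpha>) * X \<le> t T + r" "T \<subseteq> Y" "S \<subseteq> Y" "T \<inter> S = {}" "card T = 2" for S T
  proof -
    have "t S * P \<le> star_binom (n - 3) (k - card S) m * (X - t T)"
      using trace_card_cross_exact[OF assms(2,3) Y(1) T(2-4), of m] small[OF T(1)] T(5) Y(2) nk assms(1) mD(3)
      by (simp add: t_def X_def P_def)
    then have "real (t S) * P \<le> star_binom (n - 3) (k - card S) m * real (X - t T)"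
      by (metis of_nat_le_iff of_nat_mult)
    also have "\<dots> \<le> star_binom (n - 3) (k - card S) m * (\<alpha> * X + r)"
    proof (rule mult_left_mono)
      show "real (X - t T) \<le> \<alpha> * X + r"
      proof (cases "t T \<le> X")
        case True
        then show ?thesis using T(1) by (simp add: algebra_simps of_nat_diff)
      next
        case False
        then show ?thesis using assms(6) by simp
      qed
    qed simp
    finally show ?thesis .
  qed
  \<comment> \<open>Summing over the four light traces makes \<open>r\<close> appear on both sides;
    \<open>excess_bound\<close> later solves for it.\<close>
  define W where "W = star_binom (n - 3) k m + 3 * star_binom (n - 3) (k - 1) m"
  have "real r * P \<le> real W * (\<alpha> * X + r)"
    using exact[OF pairs(1), of "{}"] exact[OF pairs(1), of "{a}"] exact[OF pairs(2), of "{b}"]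
      exact[OF pairs(3), of "{c}"] abc by (simp add: W_def r_def Y_def algebra_simps)
  also have "\<dots> \<le> E * (\<alpha> * X + r)"
  proof (rule mult_right_mono)
    have "W \<le> E"
      using star_binom_vandermonde[OF mD(3), of k] nk assms(1) by (simp add: W_def E_def)
    then show "real W \<le> real E" by simp
  qed (use assms(6) in simp)
  finally have rP: "real r * P \<le> E * (\<alpha> * X + r)" .
  have EU: "E \<le> U" unfolding E_def U_def by (rule star_binom_antimono) (use mD nk in auto)
  have PX: "X \<le> 4 * P" unfolding X_def P_def mD(1) by (rule binomial_quarter[OF Dk dD(2) assms(1)])
  have reals: "0 \<le> real r" "0 \<le> real E" "0 < real X" "real X \<le> 4 * real P" "35 * real E \<le> real X"
    using PX Xpos EU unit(3) by linarith+
  have rE: "real r \<le> real_of_int d * \<alpha> / 2 * E"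
    by (rule excess_bound[OF rP reals d36 assms(6)])
  have "card (F - two_family_star n k a b c) \<le> r"
  proof -
    have "F - two_family_star n k a b c \<subseteq> (\<Union>T\<in>{{}, {a}, {b}, {c}}. {B \<in> F. B \<inter> Y = T})"
    proof
      fix B assume B: "B \<in> F - two_family_star n k a b c"
      then have "card (B \<inter> Y) < 2" using assms(2) by (auto simp: two_family_star_def Y_def not_le)
      from triple_subset_less[OF _ this[unfolded Y_def]]
      have "B \<inter> Y \<in> {{}, {a}, {b}, {c}}" unfolding Y_def by blast
      then show "B \<in> (\<Union>T\<in>{{}, {a}, {b}, {c}}. {B \<in> F. B \<inter> Y = T})" using B by blast
    qed
    then have "card (F - two_family_star n k a b c) \<le> card (\<Union>T\<in>{{}, {a}, {b}, {c}}. {B \<in> F. B \<inter> Y = T})"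
      by (rule card_mono[rotated]) (use fF in auto)
    also have "\<dots> \<le> (\<Sum>T\<in>{{}, {a}, {b}, {c}}. card {B \<in> F. B \<inter> Y = T})"
      by (rule card_UN_le) simp
    also have "\<dots> = r" using abc by (simp add: r_def t_def trace_card_def)
    finally show ?thesis .
  qed
  then have first: "real (card (F - two_family_star n k a b c)) \<le> real_of_int d * \<alpha> / 2 * E"
    using rE by linarith
  \<comment> \<open>\<open>X\<close> counts all \<open>k\<close>-sets with trace \<open>T\<close>,
    so what is missing from \<open>F\<close> is again the deficiency of the pair.\<close>
  have missing: "card {B \<in> nsets {1..n} k - F. B \<inter> Y = T} \<le> \<alpha> * X + r"
    if T: "(1 - \<alpha>) * X \<le> t T + r" "T \<subseteq> Y" "card T = 2" for T
  proof -
    have fN: "finite (nsets {1..n} k)" by (rule finite_imp_finite_nsets) simp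
    have "{B \<in> nsets {1..n} k. B \<inter> Y = T} = {B \<in> nsets {1..n} k - F. B \<inter> Y = T} \<union> {B \<in> F. B \<inter> Y = T}"
      using assms(2) by auto
    then have "trace_card (nsets {1..n} k) Y T = card {B \<in> nsets {1..n} k - F. B \<inter> Y = T} + t T"
      unfolding t_def trace_card_def by (simp, subst card_Un_disjoint) (use fN fF in auto)
    then have "card {B \<in> nsets {1..n} k - F. B \<inter> Y = T} + t T \<le> X"
      using trace_card_le[of "nsets {1..n} k" n k Y T] Y T by (simp add: X_def)
    then have "real (card {B \<in> nsets {1..n} k - F. B \<inter> Y = T}) + t T \<le> X" by linarith
    then show ?thesis using T(1) by (simp add: algebra_simps)
  qed
  have "card (two_family n k a b c - F) \<le> 3 * (\<alpha> * X + r)"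
  proof -
    have "two_family n k a b c - F \<subseteq> (\<Union>T\<in>{{b, c}, {a, c}, {a, b}}. {B \<in> nsets {1..n} k - F. B \<inter> Y = T})"
    proof
      fix B assume B: "B \<in> two_family n k a b c - F"
      then have "card (B \<inter> Y) = 2" by (simp add: two_family_def Y_def)
      from triple_subset_two[OF abc(2-4) _ this[unfolded Y_def]]
      have "B \<inter> Y \<in> {{b, c}, {a, c}, {a, b}}" unfolding Y_def by blast
      then show "B \<in> (\<Union>T\<in>{{b, c}, {a, c}, {a, b}}. {B \<in> nsets {1..n} k - F. B \<inter> Y = T})"
        using B unfolding two_family_def by blast
    qed
    then have "card (two_family n k a b c - F) \<le> card (\<Union>T\<in>{{b, c}, {a, c}, {a, b}}. {B \<in> nsets {1..n} k - F. B \<inter> Y = T})"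
      by (rule card_mono[rotated]) (use finite_imp_finite_nsets[of "{1..n}" k] in auto)
    also have "\<dots> \<le> (\<Sum>T\<in>{{b, c}, {a, c}, {a, b}}. card {B \<in> nsets {1..n} k - F. B \<inter> Y = T})"
      by (rule card_UN_le) simp
    finally have "real (card (two_family n k a b c - F)) \<le>
      real (\<Sum>T\<in>{{b, c}, {a, c}, {a, b}}. card {B \<in> nsets {1..n} k - F. B \<inter> Y = T})"
      by (simp only: of_nat_le_iff)
    also have "\<dots> \<le> (\<Sum>T\<in>{{b, c}, {a, c}, {a, b}}. \<alpha> * X + r)"
      unfolding of_nat_sum
      by (rule sum_mono) (use missing pairs abc in \<open>auto simp: Y_def\<close>)
    also have "\<dots> = real (card {{b, c}, {a, c}, {a, b}}) * (\<alpha> * X + r)" by (rule sum_constant)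
    also have "\<dots> \<le> 3 * (\<alpha> * X + r)"
    proof (rule mult_right_mono)
      have "card {{b, c}, {a, c}, {a, b}} \<le> 3" by (simp add: card_insert_if)
      then show "real (card {{b, c}, {a, c}, {a, b}}) \<le> 3" by linarith
    qed (use assms(6) in simp)
    finally show ?thesis .
  qed
  then have second: "real (card (two_family n k a b c - F)) \<le> 3 * \<alpha> * X + 3 * real_of_int d * \<alpha> / 2 * E"
    using rE by (simp add: algebra_simps)
  have "{a, b, c} \<in> nsets {1..n} 3" using Y by (simp add: nsets_def Y_def)
  then show ?thesis using first second unfolding ibX ibE by blast
qed

end
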